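(* Let $A$ be a finite totally ordered alphabet and let $\alpha$ and $\beta$ be $\bar\kappa$-terms over $A$ that are both in canonical form. If every finite semigroup satisfies the $\bar\kappa$-identity $\alpha=\beta$, then $\alpha$ and $\beta$ are the same $\bar\kappa$-term.
   Context: **Terms.** Let $A$ be a finite alphabet with a fixed total order. A $\bar\kappa$-term over $A$ is a formal expression built from the letters of $A$ using binary concatenation and the unary operations $x\mapsto x^{\omega+q}$, one for each $q\in\mathbb{Z}$ (with $x^{\omega}=x^{\omega+0}$); terms differing only in the order in which concatenations are carried out are identified. A term is identified with a nonempty well-parenthesized word over the alphabet $A_{\mathbb Z}=A\uplus\{(_q,\ )_q : q\in\mathbb{Z}\}$ having no factor $(_q\,)_q$, by writing each subterm $(\delta)^{\omega+q}$ as $(_q\,\delta\,)_q$. For convenience the empty term (empty word) is also allowed as an auxiliary object (identities are between nonempty terms). Equality, prefix, suffix are understood for the corresponding words over $A_{\mathbb Z}$. The rank of a term is the maximum number of nested pairs of parentheses in it. Every term $\alpha$ of rank $i+1$ factorizes uniquely as $\alpha=\gamma_0\delta_1^{\omega+q_1}\gamma_1\cdots\delta_n^{\omega+q_n}\gamma_n$ with $n\ge 1$, $q_k\in\mathbb Z$, $\mathrm{rank}(\gamma_j)\le i$ and $\mathrm{rank}(\delta_k)=i$. **Lyndon terms.** A term is primitive if it is not of the form $\alpha^n$ with $\alpha$ a term and $n>1$. Terms $\alpha,\beta$ are conjugate if $\alpha=\gamma_1\gamma_2$ and $\beta=\gamma_2\gamma_1$ for some (possibly empty) terms $\gamma_1,\gamma_2$.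 The order on $A$ is extended to $A_{\mathbb Z}$ by $(_p\,<\,(_q\,<\,x\,<\,)_q\,<\,)_p$ for all $x\in A$ and $p<q$ in $\mathbb Z$. A Lyndon term is a primitive term that is minimal in its conjugacy class for the lexicographic order. **Canonical forms.** Rank 0 canonical forms are the words of $A^*$. Recursively, a rank $i+1$ canonical form is a term $\alpha$ of rank $i+1$ whose unique factorization $\alpha=\gamma_0\delta_1^{\omega+q_1}\gamma_1\cdots\delta_n^{\omega+q_n}\gamma_n$ with $n\ge 1$, $q_k\in\mathbb Z$, $\mathrm{rank}(\gamma_j)\le i$ and $\mathrm{rank}(\delta_k)=i$ satisfies: (cf.1) the term $\gamma_0\delta_1^2\gamma_1\cdots\delta_n^2\gamma_n$ is a rank $i$ canonical form; (cf.2) each $\delta_k$ is a Lyndon term of rank $i$; (cf.3) no $\delta_k$ is a suffix of $\gamma_{k-1}$; (cf.4) no $\delta_k$ is a prefix of a term $\gamma_k\delta_{k+1}^{\ell}$ with $\ell\ge 0$ (for $k=n$: $\delta_n$ is not a prefix of $\gamma_n$). **Interpretation.** On a finite semigroup $S$, concatenation is interpreted as multiplication, and $s^{\omega+q}$ is: the unique idempotent power $s^\omega$ of $s$ if $q=0$; $s^\omega s^q$ if $q>0$; the inverse of $s^{\omega-q}=s^{\omega}s^{-q}$ in the maximal subgroup containing $s^\omega$ if $q<0$. $S$ satisfies $\alpha=\beta$ if $\alpha$ and $\beta$ take the same value in $S$ under every map $A\to S$. *)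

theory Defs
  imports "HOL-Algebra.Group" "HOL-Library.Sublist"
begin

section \<open>Terms\<close>

text \<open>
  A term is a list of factors, each of which is a letter or a power; lists account for the
  identification of terms that differ only by associativity. \<open>Pow \<delta> q\<close> stands for
  \<open>\<delta>\<^sup>\<omega>\<^sup>+\<^sup>q\<close>.
\<close>

datatype 'a factor = Letter 'a | Pow "'a factor list" int

type_synonym 'a kterm = "'a factor list"

text \<open>
  The raw type also contains powers of the empty list, which are not terms. The empty list itself
  is admitted as the empty term by \<open>kterm0\<close> and excluded by \<open>kterm\<close>.
\<close>

fun wf_factor :: "'a factor \<Rightarrow> bool" where
  "wf_factor (Letter a) \<longleftrightarrow> True"
| "wf_factor (Pow \<delta> q) \<longleftrightarrow> \<delta> \<noteq> [] \<and> (\<forall>x\<in>set \<delta>. wf_factor x)"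

definition kterm0 :: "'a kterm \<Rightarrow> bool" where
  "kterm0 \<alpha> \<longleftrightarrow> (\<forall>x\<in>set \<alpha>. wf_factor x)"

definition kterm :: "'a kterm \<Rightarrow> bool" where
  "kterm \<alpha> \<longleftrightarrow> kterm0 \<alpha> \<and> \<alpha> \<noteq> []"

definition tpow :: "'a kterm \<Rightarrow> nat \<Rightarrow> 'a kterm" where
  "tpow \<alpha> n = concat (replicate n \<alpha>)"

fun rank_factor :: "'a factor \<Rightarrow> nat" where
  "rank_factor (Letter a) = 0"
| "rank_factor (Pow \<delta> q) = Suc (Max (insert 0 (set (map rank_factor \<delta>))))"

definition rank :: "'a kterm \<Rightarrow> nat" where
  "rank \<alpha> = Max (insert 0 (set (map rank_factor \<alpha>)))"


section \<open>Terms as well-parenthesized words\<close>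

datatype 'a symb = LPar int | Sym 'a | RPar int

text \<open>
  Left parentheses are ordered by their index, right parentheses by the reverse order of their
  index, and the letters lie in between.
\<close>

instantiation symb :: (linorder) linorder
begin

fun less_symb :: "'a symb \<Rightarrow> 'a symb \<Rightarrow> bool" where
  "LPar p < LPar q \<longleftrightarrow> p < q"
| "LPar p < Sym y \<longleftrightarrow> True"
| "LPar p < RPar q \<longleftrightarrow> True"
| "Sym x < LPar q \<longleftrightarrow> False"
| "Sym x < Sym y \<longleftrightarrow> x < y"
| "Sym x < RPar q \<longleftrightarrow> True"
| "RPar p < LPar q \<longleftrightarrow> False"
| "RPar p < Sym y \<longleftrightarrow> False"
| "RPar p < RPar q \<longleftrightarrow> q < p"

definition less_eq_symb :: "'a symb \<Rightarrow> 'a symb \<Rightarrow> bool" where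
  "s \<le> t \<longleftrightarrow> s < t \<or> s = (t :: 'a symb)"

instance
proof
  fix x y z :: "'a symb"
  show "x < y \<longleftrightarrow> x \<le> y \<and> \<not> y \<le> x"
    by (cases x; cases y) (auto simp: less_eq_symb_def)
  show "x \<le> x"
    by (simp add: less_eq_symb_def)
  show "x \<le> y \<Longrightarrow> y \<le> z \<Longrightarrow> x \<le> z"
    by (cases x; cases y; cases z) (auto simp: less_eq_symb_def)
  show "x \<le> y \<Longrightarrow> y \<le> x \<Longrightarrow> x = y"
    by (cases x; cases y) (auto simp: less_eq_symb_def)
  show "x \<le> y \<or> y \<le> x"
    by (cases x; cases y) (auto simp: less_eq_symb_def)
qed

end

fun word_factor :: "'a factor \<Rightarrow> 'a symb list" where
  "word_factor (Letter a) = [Sym a]"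
| "word_factor (Pow \<delta> q) = LPar q # concat (map word_factor \<delta>) @ [RPar q]"

definition word :: "'a kterm \<Rightarrow> 'a symb list" where
  "word \<alpha> = concat (map word_factor \<alpha>)"

text \<open>Equality of terms is equality of the associated words.\<close>

lemma word_factor_append_inject:
  "word_factor x @ u = word_factor y @ v \<Longrightarrow> x = y \<and> u = v"
proof (induction x arbitrary: y u v)
  case (Letter a)
  then show ?case by (cases y) auto
next
  case (Pow \<delta> p)
  then obtain \<delta>' p' where y: "y = Pow \<delta>' p'"
    by (cases y) auto
  have body: "xs = ys \<and> p = p' \<and> u = v"
    if "set xs \<subseteq> set \<delta>"
      and "concat (map word_factor xs) @ RPar p # u = concat (map word_factor ys) @ RPar p' # v"
    for xs ys
    using that
  proof (induction xs arbitrary: ys)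
    case Nil
    then show ?case
      by (cases ys; cases "hd ys") auto
  next
    case (Cons x xs)
    show ?case
    proof (cases ys)
      case Nil
      then show ?thesis using Cons.prems(2) by (cases x) auto
    next
      case ys: (Cons y ys')
      have "x = y \<and> concat (map word_factor xs) @ RPar p # u =
          concat (map word_factor ys') @ RPar p' # v"
        using Pow.IH[of x] Cons.prems ys by simp
      then show ?thesis
        using Cons.IH[of ys'] Cons.prems(1) ys by simp
    qed
  qed
  show ?case
    using body[OF order_refl, of \<delta>'] Pow.prems y by (metis append_Cons append_Nil append_assoc list.inject word_factor.simps(2))
qed

lemma word_inject: "word \<alpha> = word \<beta> \<longleftrightarrow> \<alpha> = \<beta>"
proof
  assume "word \<alpha> = word \<beta>"
  then have "word_factor (Pow \<alpha> 0) @ [] = word_factor (Pow \<beta> 0) @ []"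
    by (simp add: word_def)
  from word_factor_append_inject[OF this] show "\<alpha> = \<beta>"
    by simp
qed simp

definition term_prefix :: "'a kterm \<Rightarrow> 'a kterm \<Rightarrow> bool" where
  "term_prefix \<alpha> \<beta> \<longleftrightarrow> prefix (word \<alpha>) (word \<beta>)"

definition term_suffix :: "'a kterm \<Rightarrow> 'a kterm \<Rightarrow> bool" where
  "term_suffix \<alpha> \<beta> \<longleftrightarrow> suffix (word \<alpha>) (word \<beta>)"


section \<open>Lyndon terms\<close>

definition primitive_term :: "'a kterm \<Rightarrow> bool" where
  "primitive_term \<alpha> \<longleftrightarrow> kterm \<alpha> \<and> \<not> (\<exists>\<beta> n. kterm \<beta> \<and> n > 1 \<and> \<alpha> = tpow \<beta> n)"

definition conjugate :: "'a kterm \<Rightarrow> 'a kterm \<Rightarrow> bool" where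
  "conjugate \<alpha> \<beta> \<longleftrightarrow>
     (\<exists>\<gamma>\<^sub>1 \<gamma>\<^sub>2. kterm0 \<gamma>\<^sub>1 \<and> kterm0 \<gamma>\<^sub>2 \<and> \<alpha> = \<gamma>\<^sub>1 @ \<gamma>\<^sub>2 \<and> \<beta> = \<gamma>\<^sub>2 @ \<gamma>\<^sub>1)"

definition lyndon :: "'a::linorder kterm \<Rightarrow> bool" where
  "lyndon \<alpha> \<longleftrightarrow>
     primitive_term \<alpha> \<and> (\<forall>\<beta>. conjugate \<alpha> \<beta> \<longrightarrow> ord_class.lexordp_eq (word \<alpha>) (word \<beta>))"


section \<open>Canonical forms\<close>

text \<open>
  \<open>factorization i \<alpha> n \<gamma> \<delta> q\<close> says that \<open>\<alpha> = \<gamma> 0 \<cdot> Pow (\<delta> 1) (q 1) \<cdot> \<gamma> 1 \<cdots> Pow (\<delta> n) (q n) \<cdot> \<gamma> n\<close>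
  is the factorization of the term \<open>\<alpha>\<close> of
  rank \<open>i + 1\<close>. Only the values \<open>\<gamma> 0, \<dots>, \<gamma> n\<close>, \<open>\<delta> 1, \<dots>, \<delta> n\<close> and \<open>q 1, \<dots>, q n\<close> matter, and
  these are determined by \<open>\<alpha>\<close>: the powers are the factors of \<open>\<alpha>\<close> of rank \<open>i + 1\<close>.
\<close>

definition factorization ::
  "nat \<Rightarrow> 'a kterm \<Rightarrow> nat \<Rightarrow> (nat \<Rightarrow> 'a kterm) \<Rightarrow> (nat \<Rightarrow> 'a kterm) \<Rightarrow> (nat \<Rightarrow> int) \<Rightarrow> bool" where
  "factorization i \<alpha> n \<gamma> \<delta> q \<longleftrightarrow>
     n \<ge> 1 \<and>
     \<alpha> = \<gamma> 0 @ concat (map (\<lambda>k. [Pow (\<delta> k) (q k)] @ \<gamma> k) [1..<Suc n]) \<and>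
     (\<forall>j\<in>{0..n}. rank (\<gamma> j) \<le> i) \<and>
     (\<forall>k\<in>{1..n}. rank (\<delta> k) = i)"

primrec canonical_of_rank :: "nat \<Rightarrow> 'a::linorder kterm \<Rightarrow> bool" where
  "canonical_of_rank 0 \<alpha> \<longleftrightarrow> kterm0 \<alpha> \<and> rank \<alpha> = 0"
| "canonical_of_rank (Suc i) \<alpha> \<longleftrightarrow>
     kterm0 \<alpha> \<and> rank \<alpha> = Suc i \<and>
     (\<exists>n \<gamma> \<delta> q. factorization i \<alpha> n \<gamma> \<delta> q \<and>
        canonical_of_rank i (\<gamma> 0 @ concat (map (\<lambda>k. tpow (\<delta> k) 2 @ \<gamma> k) [1..<Suc n])) \<and>
        (\<forall>k\<in>{1..n}. lyndon (\<delta> k)) \<and>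
        (\<forall>k\<in>{1..n}. \<not> term_suffix (\<delta> k) (\<gamma> (k - 1))) \<and>
        (\<forall>k\<in>{1..<n}. \<forall>l. \<not> term_prefix (\<delta> k) (\<gamma> k @ tpow (\<delta> (k + 1)) l)) \<and>
        \<not> term_prefix (\<delta> n) (\<gamma> n))"

definition canonical_form :: "'a::linorder kterm \<Rightarrow> bool" where
  "canonical_form \<alpha> \<longleftrightarrow> (\<exists>i. canonical_of_rank i \<alpha>)"


section \<open>Interpretation in finite semigroups\<close>

definition finite_semigroup :: "'s set \<Rightarrow> ('s \<Rightarrow> 's \<Rightarrow> 's) \<Rightarrow> bool" where
  "finite_semigroup S f \<longleftrightarrow> finite S \<and>
     (\<forall>x\<in>S. \<forall>y\<in>S. f x y \<in> S) \<and>
     (\<forall>x\<in>S. \<forall>y\<in>S. \<forall>z\<in>S. f (f x y) z = f x (f y z))"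

text \<open>Products of nonempty lists; the value on the empty list is irrelevant.\<close>

fun sprod :: "('s \<Rightarrow> 's \<Rightarrow> 's) \<Rightarrow> 's list \<Rightarrow> 's" where
  "sprod f [] = undefined"
| "sprod f [x] = x"
| "sprod f (x # y # xs) = f x (sprod f (y # xs))"

definition spow :: "('s \<Rightarrow> 's \<Rightarrow> 's) \<Rightarrow> 's \<Rightarrow> nat \<Rightarrow> 's" where
  "spow f s n = sprod f (replicate n s)"

definition idem_power :: "('s \<Rightarrow> 's \<Rightarrow> 's) \<Rightarrow> 's \<Rightarrow> 's" where
  "idem_power f s = (THE e. (\<exists>n\<ge>1. e = spow f s n) \<and> f e e = e)"

text \<open>
  A subgroup of \<open>S\<close> that contains the idempotent \<open>e\<close> necessarily has \<open>e\<close> as its identity.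
\<close>

definition max_subgroup :: "'s set \<Rightarrow> ('s \<Rightarrow> 's \<Rightarrow> 's) \<Rightarrow> 's \<Rightarrow> 's set" where
  "max_subgroup S f e = (GREATEST G. G \<subseteq> S \<and> group \<lparr>carrier = G, mult = f, one = e\<rparr>)"

definition omega_power :: "'s set \<Rightarrow> ('s \<Rightarrow> 's \<Rightarrow> 's) \<Rightarrow> 's \<Rightarrow> int \<Rightarrow> 's" where
  "omega_power S f s q =
     (let e = idem_power f s in
      if q = 0 then e
      else if q > 0 then f e (spow f s (nat q))
      else m_inv \<lparr>carrier = max_subgroup S f e, mult = f, one = e\<rparr> (f e (spow f s (nat (- q)))))"

fun eval_factor :: "'s set \<Rightarrow> ('s \<Rightarrow> 's \<Rightarrow> 's) \<Rightarrow> ('a \<Rightarrow> 's) \<Rightarrow> 'a factor \<Rightarrow> 's" where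
  "eval_factor S f h (Letter a) = h a"
| "eval_factor S f h (Pow \<delta> q) = omega_power S f (sprod f (map (eval_factor S f h) \<delta>)) q"

definition eval_term :: "'s set \<Rightarrow> ('s \<Rightarrow> 's \<Rightarrow> 's) \<Rightarrow> ('a \<Rightarrow> 's) \<Rightarrow> 'a kterm \<Rightarrow> 's" where
  "eval_term S f h \<alpha> = sprod f (map (eval_factor S f h) \<alpha>)"

definition satisfies :: "'s set \<Rightarrow> ('s \<Rightarrow> 's \<Rightarrow> 's) \<Rightarrow> 'a kterm \<Rightarrow> 'a kterm \<Rightarrow> bool" where
  "satisfies S f \<alpha> \<beta> \<longleftrightarrow> (\<forall>h. range h \<subseteq> S \<longrightarrow> eval_term S f h \<alpha> = eval_term S f h \<beta>)"

text \<open>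
  Every finite semigroup is isomorphic to one whose carrier is a set of natural numbers, so these
  represent all finite semigroups.
\<close>

definition all_finite_semigroups_satisfy :: "'a kterm \<Rightarrow> 'a kterm \<Rightarrow> bool" where
  "all_finite_semigroups_satisfy \<alpha> \<beta> \<longleftrightarrow>
     (\<forall>(S :: nat set) f. finite_semigroup S f \<longrightarrow> satisfies S f \<alpha> \<beta>)"

end

theory Submission
  imports Defs
begin

text \<open>
  Replace every power \<open>\<delta>\<^sup>\<omega>\<^sup>+\<^sup>q\<close> in a term by ordinary powers \<open>\<delta>\<^sup>m\<close> with \<open>m \<ge> N\<close> and
  \<open>m \<equiv> q (mod p)\<close>. The words that arise form a regular language, so a finite semigroup recognizes it,
  and in that semigroup the value of the term is the image of one of these words. Hence if
  \<open>\<alpha> = \<beta>\<close> holds in all finite semigroups, the languages of \<open>\<alpha>\<close> and \<open>\<beta>\<close> have a common word.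

  It remains to recover a canonical form from any word of its language when \<open>N\<close> and \<open>p\<close> are large.
  This is done rank by rank. By the argument of Fine and Wilf, two long powers of Lyndon terms that
  overlap are powers of the same term, and (cf.3) and (cf.4) then force the places where they begin
  and end to coincide. The bounds required at each rank depend on the canonical form only and not on
  its long expansions, since everything that occurs between two consecutive powers in an
  expansion already occurs when each \<open>\<delta>\<^sup>\<omega>\<^sup>+\<^sup>q\<close> is replaced by \<open>\<delta>\<^sup>2\<close>.
\<close>

section \<open>Omega powers in finite semigroups\<close>

lemma sprod_Cons: "xs \<noteq> [] \<Longrightarrow> sprod f (x # xs) = f x (sprod f xs)"
  by (cases xs) auto

lemma sprod_closed:
  assumes "finite_semigroup S f" "xs \<noteq> []" "set xs \<subseteq> S"
  shows "sprod f xs \<in> S"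
  using assms(2,3)
proof (induction xs)
  case (Cons x xs)
  then show ?case
    using assms(1) by (cases "xs = []") (auto simp: sprod_Cons finite_semigroup_def)
qed simp

lemma sprod_append:
  assumes "finite_semigroup S f" "xs \<noteq> []" "ys \<noteq> []" "set xs \<subseteq> S" "set ys \<subseteq> S"
  shows "sprod f (xs @ ys) = f (sprod f xs) (sprod f ys)"
  using assms(2,4)
proof (induction xs)
  case (Cons x xs)
  have "sprod f ys \<in> S" using assms by (simp add: sprod_closed)
  moreover have "xs \<noteq> [] \<Longrightarrow> sprod f xs \<in> S"
    using Cons.prems assms(1) by (simp add: sprod_closed)
  ultimately show ?case
    using Cons assms(1,3) by (cases "xs = []") (auto simp: sprod_Cons finite_semigroup_def)
qed simp

locale finite_semigroup_element =
  fixes S :: "'s set" and f :: "'s \<Rightarrow> 's \<Rightarrow> 's" and s :: 's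
  assumes semigroup: "finite_semigroup S f" and elem: "s \<in> S"
begin

lemma assoc: "x \<in> S \<Longrightarrow> y \<in> S \<Longrightarrow> z \<in> S \<Longrightarrow> f (f x y) z = f x (f y z)"
  using semigroup by (simp add: finite_semigroup_def)

lemma closed: "x \<in> S \<Longrightarrow> y \<in> S \<Longrightarrow> f x y \<in> S"
  using semigroup by (simp add: finite_semigroup_def)

lemma spow_closed: "n > 0 \<Longrightarrow> spow f s n \<in> S"
  unfolding spow_def using sprod_closed[OF semigroup, of "replicate n s"] elem by auto

lemma spow_add: "m > 0 \<Longrightarrow> n > 0 \<Longrightarrow> spow f s (m + n) = f (spow f s m) (spow f s n)"
  unfolding spow_def replicate_add
  using sprod_append[OF semigroup, of "replicate m s" "replicate n s"] elem by auto

lemma spow_idem_mult: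
  assumes "n > 0" "f (spow f s n) (spow f s n) = spow f s n" "t > 0"
  shows "spow f s (n * t) = spow f s n"
  using assms(3)
proof (induction t)
  case (Suc t)
  then show ?case
    using assms(1,2) spow_add[of n "n * t"] by (cases "t = 0") auto
qed simp

text \<open>By the pigeonhole principle two powers of \<open>s\<close> coincide, so from some
  exponent \<open>a\<close> on the powers repeat with a period \<open>d\<close>. An exponent that is
  at least \<open>a\<close> and a multiple of \<open>d\<close> gives an idempotent.\<close>

lemma ex_idem_spow: "\<exists>n>0. f (spow f s n) (spow f s n) = spow f s n"
proof -
  have "finite S" using semigroup by (simp add: finite_semigroup_def)
  then have "\<not> inj_on (spow f s) {0<..}"
    using finite_image_iff[of "spow f s" "{0<..}"] infinite_Ioi[of "0::nat"]
      finite_subset[of "spow f s ` {0<..}" S] spow_closed by auto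
  then obtain a b where ab: "a > 0" "a < b" "spow f s a = spow f s b"
    by (metis greaterThan_iff linorder_inj_onI')
  define d where "d = b - a"
  have d: "d > 0" "spow f s (a + d) = spow f s a" using ab by (auto simp: d_def)
  have step: "spow f s (n + d) = spow f s n" if "n \<ge> a" for n
  proof (cases "n = a")
    case False
    then have "spow f s (a + d + (n - a)) = spow f s (a + (n - a))"
      using that d ab by (subst (1 2) spow_add) auto
    then show ?thesis using that by (simp add: add.commute add.left_commute)
  qed (use d in simp)
  have "spow f s (n + t * d) = spow f s n" if "n \<ge> a" for n t
  proof (induction t)
    case (Suc t)
    then show ?case using step[of "n + t * d"] that by (simp add: add.commute add.left_commute)
  qed simp
  \<comment> \<open>The exponent \<open>a * d\<close> is both at least \<open>a\<close> and a
    multiple of the period, so doubling it changes nothing.\<close>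
  from this[of "a * d" a] have "spow f s (a * d + a * d) = spow f s (a * d)"
    using d by simp
  then show ?thesis using spow_add[of "a * d" "a * d"] ab d by (intro exI[of _ "a * d"]) auto
qed

lemma idem_power_eq:
  assumes "n > 0" "f (spow f s n) (spow f s n) = spow f s n"
  shows "idem_power f s = spow f s n"
  unfolding idem_power_def
proof (rule the_equality)
  show "(\<exists>m\<ge>1. spow f s n = spow f s m) \<and> f (spow f s n) (spow f s n) = spow f s n"
    using assms by (auto intro!: exI[of _ n])
next
  fix e assume "(\<exists>m\<ge>1. e = spow f s m) \<and> f e e = e"
  then obtain m where "m > 0" "e = spow f s m" "f e e = e" by (auto simp: Suc_le_eq)
  \<comment> \<open>Idempotent powers with exponents \<open>m\<close> and \<open>n\<close> both
    equal the power with exponent \<open>m * n\<close>.\<close>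
  then show "e = spow f s n"
    using assms spow_idem_mult[of m n] spow_idem_mult[of n m] by (simp add: mult.commute)
qed

text \<open>\<open>G\<close> is the group of units of the monoid e S e. In any subgroup with
  identity \<open>e\<close> the elements have inverses inside e S e, so \<open>G\<close> contains
  it; hence the maximum meant by \<open>GREATEST\<close> exists.\<close>

lemma max_subgroup_eq:
  assumes "e \<in> S" "f e e = e"
  defines "G \<equiv> {x \<in> S. f e x = x \<and> f x e = x \<and>
    (\<exists>y\<in>S. f e y = y \<and> f y e = y \<and> f x y = e \<and> f y x = e)}"
  shows "max_subgroup S f e = G" and "group \<lparr>carrier = G, mult = f, one = e\<rparr>"
proof -
  have mem: "x \<in> G" if "x \<in> S" "y \<in> S" "f e x = x" "f x e = x" "f e y = y" "f y e = y"
    "f x y = e" "f y x = e" for x y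
    using that unfolding G_def by blast
  show G: "group \<lparr>carrier = G, mult = f, one = e\<rparr>"
  proof (rule groupI, simp_all)
    fix x y assume "x \<in> G" "y \<in> G"
    then obtain x' y' where
      x: "x \<in> S" "x' \<in> S" "f e x = x" "f x e = x" "f e x' = x'" "f x' e = x'" "f x x' = e" "f x' x = e" and
      y: "y \<in> S" "y' \<in> S" "f e y = y" "f y e = y" "f e y' = y'" "f y' e = y'" "f y y' = e" "f y' y = e"
      unfolding G_def by blast
    have "f (f x y) (f y' x') = f x (f (f y y') x')"
      using x(1,2) y(1,2) by (simp only: assoc closed)
    then have 1: "f (f x y) (f y' x') = e" using x y by simp
    have "f (f y' x') (f x y) = f y' (f (f x' x) y)"
      using x(1,2) y(1,2) by (simp only: assoc closed)
    then have 2: "f (f y' x') (f x y) = e" using x y by simp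
    have "f e (f x y) = f x y" "f e (f y' x') = f y' x'"
      using x y assms(1) by (simp_all add: assoc[symmetric])
    moreover have "f (f x y) e = f x y" "f (f y' x') e = f y' x'"
      using x y assms(1) by (simp_all add: assoc)
    ultimately show "f x y \<in> G"
      using x(1,2) y(1,2) 1 2 by (intro mem[of _ "f y' x'"]) (simp_all add: closed)
  next
    show "e \<in> G" using assms by (auto simp: G_def)
  next
    fix x assume "x \<in> G"
    then show "f e x = x" by (simp add: G_def)
    show "\<exists>y\<in>G. f y x = e"
      using \<open>x \<in> G\<close> unfolding G_def by blast
  qed (simp add: assoc G_def)
  show "max_subgroup S f e = G"
    unfolding max_subgroup_def
  proof (rule Greatest_equality)
    show "G \<subseteq> S \<and> group \<lparr>carrier = G, mult = f, one = e\<rparr>"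
      using G by (auto simp: G_def)
  next
    fix H assume H: "H \<subseteq> S \<and> group \<lparr>carrier = H, mult = f, one = e\<rparr>"
    let ?H = "\<lparr>carrier = H, mult = f, one = e\<rparr>"
    interpret H: group ?H using H by simp
    show "H \<le> G"
    proof
      fix x assume x: "x \<in> H"
      have i: "m_inv ?H x \<in> H" using H.inv_closed[of x] x by simp
      show "x \<in> G"
        using x i H H.l_one[of x] H.r_one[of x] H.l_one[of "m_inv ?H x"] H.r_one[of "m_inv ?H x"]
          H.l_inv[of x] H.r_inv[of x]
        by (intro mem[of x "m_inv ?H x"]) auto
    qed
  qed
qed

text \<open>One ordinary power covers the three cases of the definition. This is what later turns an
  omega power into a word power. The bound on \<open>q\<close> keeps the exponent above
  \<open>n\<close>, hence inside the maximal subgroup.\<close>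

lemma omega_power_eq_spow:
  assumes "n > 0" "f (spow f s n) (spow f s n) = spow f s n" "\<bar>q\<bar> < int n"
  shows "omega_power S f s q = spow f s (nat (2 * int n + q))"
proof -
  define e where "e = spow f s n"
  have e: "e \<in> S" "f e e = e" "idem_power f s = e"
    using assms by (simp_all add: e_def spow_closed idem_power_eq)
  have e2: "spow f s (n + n) = e" using assms by (simp add: e_def spow_add)
  \<comment> \<open>Powers with exponent above \<open>n\<close> lie in e S e.\<close>
  have absorb: "f e (spow f s (n + m)) = spow f s (n + m)" "f (spow f s (n + m)) e = spow f s (n + m)"
    if "m > 0" for m
    using that assms(1) e spow_add[of n m] spow_add[of m n] spow_closed[of m]
    by (simp_all add: e_def[symmetric] assoc[of e e, symmetric] add.commute[of m n] assoc)
      (metis add.commute assoc e_def spow_add)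
  consider "q = 0" | "q > 0" | "q < 0" by linarith
  then show ?thesis
  proof cases
    case 1
    have "nat (2 * int n + q) = n + n" using 1 by simp
    then show ?thesis using 1 e e2 by (simp only: omega_power_def Let_def if_True simp_thms)
  next
    case 2
    have "nat (2 * int n + q) = (n + n) + nat q" using 2 by simp
    then show ?thesis
      using 2 e(3) e2 assms(1) spow_add[of "n + n" "nat q"] by (simp add: omega_power_def)
  next
    case 3
    define k where "k = nat (- q)"
    have k: "k > 0" "k < n" "nat (2 * int n + q) = n + (n - k)" using 3 assms by (auto simp: k_def)
    define x where "x = spow f s (n + k)"
    define y where "y = spow f s (n + (n - k))"
    have xS: "x \<in> S" "y \<in> S" using k by (simp_all add: x_def y_def spow_closed)
    have ex: "f e (spow f s k) = x" using assms k by (simp add: x_def e_def spow_add)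
    have exy: "f e x = x" "f x e = x" "f e y = y" "f y e = y"
      using absorb[of k] absorb[of "n - k"] k by (simp_all add: x_def y_def)
    \<comment> \<open>The exponents of \<open>x\<close> and \<open>y\<close> add up to
      \<open>3 * n\<close>, so the two powers are mutually inverse.\<close>
    have cube: "spow f s (n * 3) = e" using assms spow_idem_mult[of n 3] by (simp add: e_def)
    have sum: "n + k + (n + (n - k)) = n * 3" "n + (n - k) + (n + k) = n * 3"
      using k by simp_all
    have xy: "f x y = e" "f y x = e"
      using k assms(1) unfolding x_def y_def
      by (subst spow_add[symmetric]; simp only: sum cube)+
    let ?G = "\<lparr>carrier = max_subgroup S f e, mult = f, one = e\<rparr>"
    have G: "group ?G" using max_subgroup_eq[OF e(1,2)] by simp
    have mem: "x \<in> max_subgroup S f e" "y \<in> max_subgroup S f e"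
      using xS exy xy unfolding max_subgroup_eq(1)[OF e(1,2)] by blast+
    have "m_inv ?G x = y"
      using group.inv_equality[OF G, of y x] mem xy by simp
    then show ?thesis
      using 3 e ex k by (simp add: omega_power_def k_def[symmetric] y_def)
  qed
qed

end

section \<open>Languages with finitely many left quotients\<close>

definition quot :: "'b list \<Rightarrow> 'b list set \<Rightarrow> 'b list set" where
  "quot u L = {w. u @ w \<in> L}"

text \<open>By the Myhill-Nerode theorem this is regularity. The quotients serve directly as the
  states of the minimal automaton.\<close>

definition regular :: "'b list set \<Rightarrow> bool" where
  "regular L \<longleftrightarrow> finite (range (\<lambda>u. quot u L))"

definition conc :: "'b list set \<Rightarrow> 'b list set \<Rightarrow> 'b list set" where
  "conc X Y = {x @ y | x y. x \<in> X \<and> y \<in> Y}"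

definition conc_list :: "'b list set list \<Rightarrow> 'b list set" where
  "conc_list Xs = foldr conc Xs {[]}"

lemma conc_list_simps [simp]:
  "conc_list [] = {[]}" "conc_list (X # Xs) = conc X (conc_list Xs)"
  by (simp_all add: conc_list_def)

lemma concI: "x \<in> X \<Longrightarrow> y \<in> Y \<Longrightarrow> x @ y \<in> conc X Y"
  by (auto simp: conc_def)

lemma conc_assoc: "conc (conc X Y) Z = conc X (conc Y Z)"
  unfolding conc_def by (auto; metis append_assoc)

lemma conc_Nil [simp]: "conc {[]} X = X" "conc X {[]} = X"
  by (auto simp: conc_def)

lemma conc_list_append: "conc_list (Xs @ Ys) = conc (conc_list Xs) (conc_list Ys)"
  by (induction Xs) (simp_all add: conc_assoc)

text \<open>The common scheme of the closure proofs: every quotient is a union of members of one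
  fixed finite family.\<close>

lemma finite_Union_of_subsets:
  assumes "finite F" "\<And>x. \<exists>P\<subseteq>F. g x = \<Union>P"
  shows "finite (range g)"
proof (rule finite_subset)
  show "range g \<subseteq> Union ` Set.Pow F"
  proof safe
    fix x
    obtain P where "P \<subseteq> F" "g x = \<Union>P" using assms(2) by blast
    then show "g x \<in> Union ` Set.Pow F" by (intro image_eqI[of _ _ P]) auto
  qed
qed (use assms(1) in simp)

lemma regular_finite:
  assumes "finite L"
  shows "regular L"
proof -
  have "finite (\<Union>w\<in>L. set (suffixes w))"
    using assms by simp
  moreover have "range (\<lambda>u. quot u L) \<subseteq> Set.Pow (\<Union>w\<in>L. set (suffixes w))"
    by (auto simp: quot_def suffix_def)
  ultimately show ?thesis
    unfolding regular_def by (meson finite_Pow_iff finite_subset)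
qed

text \<open>The word \<open>u\<close> either ends inside the factor from \<open>X\<close>, or covers
  that factor and leaves a rest \<open>v\<close> to be read in \<open>Y\<close>.\<close>

lemma quot_conc:
  "quot u (conc X Y) = conc (quot u X) Y \<union> \<Union> {quot v Y | v v'. u = v' @ v \<and> v' \<in> X}"
  (is "?L = ?R")
proof
  show "?L \<subseteq> ?R"
  proof
    fix w assume "w \<in> ?L"
    then obtain x y where xy: "u @ w = x @ y" "x \<in> X" "y \<in> Y"
      by (auto simp: quot_def conc_def)
    then obtain z where "u = x @ z \<and> z @ w = y \<or> u @ z = x \<and> w = z @ y"
      unfolding append_eq_append_conv2 by blast
    then show "w \<in> ?R"
    proof
      assume "u = x @ z \<and> z @ w = y"
      then have "w \<in> quot z Y" "u = x @ z" using xy by (simp_all add: quot_def)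
      then show ?thesis using xy(2) by blast
    next
      assume "u @ z = x \<and> w = z @ y"
      then show ?thesis using xy by (simp add: quot_def concI)
    qed
  qed
  have "conc (quot u X) Y \<subseteq> ?L"
    unfolding quot_def conc_def by (auto, metis append_assoc)
  moreover have "quot v Y \<subseteq> ?L" if "u = v' @ v" "v' \<in> X" for v v'
    using that concI[of v' X _ Y] by (auto simp: quot_def)
  ultimately show "?R \<subseteq> ?L" by blast
qed

lemma regular_conc:
  assumes "regular X" "regular Y"
  shows "regular (conc X Y)"
  unfolding regular_def
proof (rule finite_Union_of_subsets)
  show "finite ((\<lambda>Z. conc Z Y) ` range (\<lambda>u. quot u X) \<union> range (\<lambda>u. quot u Y))"
    using assms by (simp add: regular_def)
  fix u
  show "\<exists>P\<subseteq>(\<lambda>Z. conc Z Y) ` range (\<lambda>u. quot u X) \<union> range (\<lambda>u. quot u Y).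
      quot u (conc X Y) = \<Union>P"
    by (rule exI[of _ "insert (conc (quot u X) Y) {quot v Y | v v'. u = v' @ v \<and> v' \<in> X}"])
      (auto simp: quot_conc)
qed

lemma regular_conc_list: "(\<And>X. X \<in> set Xs \<Longrightarrow> regular X) \<Longrightarrow> regular (conc_list Xs)"
  by (induction Xs) (simp_all add: regular_finite regular_conc)

text \<open>Locates the factor in which \<open>u\<close> ends: \<open>k\<close> factors are read
  completely, and the next one is split into \<open>v\<close> and \<open>w1\<close>.\<close>

lemma append_in_conc_power:
  assumes "u @ w \<in> conc_list (replicate m X)" "m > 0"
  shows "\<exists>k u' v w1 w2. k < m \<and> u = u' @ v \<and> w = w1 @ w2 \<and>
    u' \<in> conc_list (replicate k X) \<and> v @ w1 \<in> X \<and> w2 \<in> conc_list (replicate (m - Suc k) X)"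
  using assms
proof (induction m arbitrary: u)
  case (Suc m)
  then obtain x y where xy: "u @ w = x @ y" "x \<in> X" "y \<in> conc_list (replicate m X)"
    by (auto simp: conc_def)
  \<comment> \<open>If \<open>u\<close> ends exactly at the end of \<open>x\<close>, this counts as
    the first case. In the second case \<open>z\<close> is nonempty, which forces a further factor
    and allows the induction hypothesis.\<close>
  then consider z where "x = u @ z" "w = z @ y" | z where "z \<noteq> []" "u = x @ z" "z @ w = y"
    unfolding append_eq_append_conv2 by (metis append.left_neutral append.right_neutral)
  then show ?case
  proof cases
    case 1
    then show ?thesis
      using xy by (intro exI[of _ 0] exI[of _ "[]"] exI[of _ u] exI[of _ z] exI[of _ y]) simp
  next
    case 2
    then have "m > 0" using xy by (cases m) auto
    then obtain k u' v w1 w2 where "k < m" "z = u' @ v" "w = w1 @ w2"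
      "u' \<in> conc_list (replicate k X)" "v @ w1 \<in> X" "w2 \<in> conc_list (replicate (m - Suc k) X)"
      using Suc.IH[of z] 2(3) xy(3) by blast
    then show ?thesis
      using 2 xy concI[of x X u']
      by (intro exI[of _ "Suc k"] exI[of _ "x @ u'"] exI[of _ v] exI[of _ w1] exI[of _ w2]) simp
  qed
qed simp

lemma conc_power_add:
  "u \<in> conc_list (replicate k X) \<Longrightarrow> v \<in> conc_list (replicate m X) \<Longrightarrow>
    u @ v \<in> conc_list (replicate (k + m) X)"
  by (simp add: replicate_add conc_list_append concI)

text \<open>After \<open>u\<close> has used up \<open>k\<close> full factors and part of another,
  what may follow depends only on a quotient of \<open>X\<close> and on a shift of \<open>T\<close>,
  and both range over finite sets. Since \<open>T\<close> omits 0 there is always a factor in which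
  \<open>u\<close> can end.\<close>

lemma regular_conc_power:
  assumes "regular X" "0 \<notin> T" "finite (range (\<lambda>k. {m. m + k \<in> T}))"
  shows "regular (\<Union>m\<in>T. conc_list (replicate m X))"
  unfolding regular_def
proof (rule finite_Union_of_subsets)
  let ?pow = "\<lambda>T. \<Union>m\<in>T. conc_list (replicate m X)"
  let ?F = "(\<lambda>(Z, R). conc Z (?pow R)) ` (range (\<lambda>u. quot u X) \<times> range (\<lambda>k. {m. m + k \<in> T}))"
  show "finite ?F" using assms by (simp add: regular_def)
  fix u
  let ?P = "{conc (quot v X) (?pow {m. m + Suc k \<in> T}) | k v v'.
    u = v' @ v \<and> v' \<in> conc_list (replicate k X)}"
  have "quot u (?pow T) \<subseteq> \<Union>?P"
  proof
    fix w assume "w \<in> quot u (?pow T)"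
    then obtain m where m: "m \<in> T" "u @ w \<in> conc_list (replicate m X)"
      by (auto simp: quot_def)
    with assms(2) have "m > 0" by (cases m) auto
    with m obtain k u' v w1 w2 where "k < m" "u = u' @ v" "w = w1 @ w2"
      "u' \<in> conc_list (replicate k X)" "v @ w1 \<in> X" "w2 \<in> conc_list (replicate (m - Suc k) X)"
      using append_in_conc_power[of u w m X] by blast
    moreover from this have "w \<in> conc (quot v X) (?pow {m. m + Suc k \<in> T})"
      using m(1) unfolding \<open>w = w1 @ w2\<close>
      by (intro concI UN_I[of "m - Suc k"]) (simp_all add: quot_def)
    ultimately show "w \<in> \<Union>?P" by blast
  qed
  moreover have "\<Union>?P \<subseteq> quot u (?pow T)"
  proof
    fix w assume "w \<in> \<Union>?P"
    then obtain k v v' w1 w2 m where "u = v' @ v" "v' \<in> conc_list (replicate k X)" "w = w1 @ w2"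
      "v @ w1 \<in> X" "m + Suc k \<in> T" "w2 \<in> conc_list (replicate m X)"
      by (auto simp: conc_def quot_def)
    moreover from this have "v' @ (v @ w1) @ w2 \<in> conc_list (replicate (k + Suc m) X)"
      by (intro conc_power_add) (simp_all add: concI del: append_assoc)
    ultimately show "w \<in> quot u (?pow T)"
      by (auto simp: quot_def add.commute simp del: replicate_Suc intro!: bexI[of _ "m + Suc k"])
  qed
  moreover have "?P \<subseteq> ?F" by fast
  ultimately show "\<exists>P\<subseteq>?F. quot u (?pow T) = \<Union>P" by blast
qed

text \<open>The shift by \<open>k\<close> depends only on the truncated difference
  \<open>N - k\<close> and on \<open>k mod p\<close>.\<close>

lemma finite_shifts_progression:
  assumes "p > 0"
  shows "finite (range (\<lambda>k. {m. m + k \<in> {m. m \<ge> N \<and> int p dvd int m - q}}))"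
proof (rule finite_subset)
  let ?g = "\<lambda>(a, b). {m. m \<ge> a \<and> int p dvd int m + int b - q}"
  show "range (\<lambda>k. {m. m + k \<in> {m. m \<ge> N \<and> int p dvd int m - q}}) \<subseteq> ?g ` ({..N} \<times> {..<p})"
  proof safe
    fix k :: nat
    have "int p dvd int m + int (k mod p) - q \<longleftrightarrow> int p dvd int (m + k) - q" for m
    proof -
      have "int (m + k) - q = (int m + int (k mod p) - q) + int p * int (k div p)"
        by (simp flip: of_nat_mult of_nat_add)
      then show ?thesis by (metis dvd_add_left_iff dvd_triv_left)
    qed
    then have "{m. m + k \<in> {m. m \<ge> N \<and> int p dvd int m - q}} = ?g (N - k, k mod p)"
      by auto
    then show "{m. m + k \<in> {m. m \<ge> N \<and> int p dvd int m - q}} \<in> ?g ` ({..N} \<times> {..<p})"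
      using assms by (intro image_eqI[of _ _ "(N - k, k mod p)"]) auto
  qed
qed simp

text \<open>Words are identified when they act alike on the quotients of \<open>L\<close>; this is
  the transition semigroup of the minimal automaton. It recognizes \<open>L\<close> because a word
  is in \<open>L\<close> exactly when the empty word is in its quotient.\<close>

lemma regular_recognized:
  fixes L :: "'b list set"
  assumes "regular L"
  obtains g :: "'b list \<Rightarrow> nat" where "finite (range g)"
    and "\<And>u u' v v'. g u = g u' \<Longrightarrow> g v = g v' \<Longrightarrow> g (u @ v) = g (u' @ v')"
    and "\<And>u v. g u = g v \<Longrightarrow> u \<in> L \<longleftrightarrow> v \<in> L"
proof -
  define Q where "Q = range (\<lambda>u. quot u L)"
  \<comment> \<open>The action of \<open>u\<close> on the states, encoded as its graph so that all
    values lie in the finite set of subsets of \<open>Q \<times> Q\<close>.\<close>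
  define \<phi> where "\<phi> u = (\<lambda>X. (X, quot u X)) ` Q" for u
  have quot_append: "quot (u @ v) X = quot v (quot u X)" for u v :: "'b list" and X
    by (simp add: quot_def)
  have quot_Q: "X \<in> Q \<Longrightarrow> quot u X \<in> Q" for u X
    by (auto simp: Q_def simp flip: quot_append)
  have \<phi>_eq: "\<phi> u = \<phi> v \<longleftrightarrow> (\<forall>X\<in>Q. quot u X = quot v X)" for u v
    unfolding \<phi>_def by fastforce
  have "range \<phi> \<subseteq> Set.Pow (Q \<times> Q)" using quot_Q by (auto simp: \<phi>_def)
  moreover have "finite Q" using assms by (simp add: Q_def regular_def)
  ultimately have fin: "finite (range \<phi>)" by (meson finite_Pow_iff finite_SigmaI finite_subset)
  \<comment> \<open>Numbering the actions places the semigroup on natural numbers, the carrier type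
    in \<open>all_finite_semigroups_satisfy\<close>.\<close>
  then obtain c :: "_ \<Rightarrow> nat" where c: "inj_on c (range \<phi>)"
    using finite_imp_inj_to_nat_seg[OF fin] by blast
  define g where "g = c \<circ> \<phi>"
  have g_eq: "g u = g v \<longleftrightarrow> (\<forall>X\<in>Q. quot u X = quot v X)" for u v
    using inj_on_eq_iff[OF c, of "\<phi> u" "\<phi> v"] \<phi>_eq[of u v] by (simp add: g_def)
  have L: "L \<in> Q" unfolding Q_def quot_def by (rule range_eqI[of _ _ "[]"]) simp
  show thesis
  proof
    show "finite (range g)" using fin by (metis finite_imageI g_def image_comp)
    show "g (u @ v) = g (u' @ v')" if "g u = g u'" "g v = g v'" for u u' v v'
      using that quot_Q by (simp add: g_eq quot_append)
    show "u \<in> L \<longleftrightarrow> v \<in> L" if "g u = g v" for u v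
    proof -
      have "quot u L = quot v L" using that L by (simp add: g_eq)
      then have "[] \<in> quot u L \<longleftrightarrow> [] \<in> quot v L" by simp
      then show ?thesis by (simp add: quot_def)
    qed
  qed
qed

section \<open>The language of a term\<close>

text \<open>
  The exponents are chosen independently in different copies of a subterm: with equal exponents
  the language would not be regular.
\<close>

fun lang_factor :: "nat \<Rightarrow> nat \<Rightarrow> 'a factor \<Rightarrow> 'a list set" where
  "lang_factor N p (Letter a) = {[a]}"
| "lang_factor N p (Pow \<delta> q) = (\<Union>m\<in>{m. m \<ge> N \<and> int p dvd int m - q}.
     conc_list (replicate m (conc_list (map (lang_factor N p) \<delta>))))"

definition lang :: "nat \<Rightarrow> nat \<Rightarrow> 'a kterm \<Rightarrow> 'a list set" where
  "lang N p \<alpha> = conc_list (map (lang_factor N p) \<alpha>)"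

lemma lang_simps [simp]:
  "lang N p [] = {[]}" "lang N p (x # \<alpha>) = conc (lang_factor N p x) (lang N p \<alpha>)"
  by (simp_all add: lang_def)

lemma lang_append: "lang N p (\<alpha> @ \<beta>) = conc (lang N p \<alpha>) (lang N p \<beta>)"
  by (simp add: lang_def conc_list_append)

lemma tpow_simps [simp]: "tpow \<delta> 0 = []" "tpow \<delta> (Suc n) = \<delta> @ tpow \<delta> n"
  by (simp_all add: tpow_def)

lemma tpow_add: "tpow \<delta> (m + n) = tpow \<delta> m @ tpow \<delta> n"
  by (simp add: tpow_def replicate_add)

lemma lang_tpow: "lang N p (tpow \<delta> m) = conc_list (replicate m (lang N p \<delta>))"
  by (induction m) (simp_all add: lang_append)

lemma lang_factor_Pow:
  "lang_factor N p (Pow \<delta> q) = (\<Union>m\<in>{m. m \<ge> N \<and> int p dvd int m - q}. lang N p (tpow \<delta> m))"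
  unfolding lang_tpow by (simp add: lang_def)

lemma regular_lang_factor:
  assumes "N > 0" "p > 0"
  shows "regular (lang_factor N p x)"
proof (induction x)
  case (Pow \<delta> q)
  then have "regular (conc_list (map (lang_factor N p) \<delta>))"
    by (intro regular_conc_list) auto
  then show ?case
    unfolding lang_factor.simps
    using assms by (intro regular_conc_power finite_shifts_progression) auto
qed (simp add: regular_finite)

lemma regular_lang: "N > 0 \<Longrightarrow> p > 0 \<Longrightarrow> regular (lang N p \<alpha>)"
  unfolding lang_def by (intro regular_conc_list) (auto intro: regular_lang_factor)

lemma sprod_eval_in_lang:
  assumes hom: "\<And>u v. u \<noteq> [] \<Longrightarrow> v \<noteq> [] \<Longrightarrow> g (u @ v) = f (g u) (g v)"
    and factors: "\<And>x. x \<in> set \<alpha> \<Longrightarrow> \<exists>w\<in>lang_factor N p x. w \<noteq> [] \<and> e x = g w"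
    and "\<alpha> \<noteq> []"
  shows "\<exists>w\<in>lang N p \<alpha>. w \<noteq> [] \<and> sprod f (map e \<alpha>) = g w"
  using factors \<open>\<alpha> \<noteq> []\<close>
proof (induction \<alpha>)
  case (Cons x \<alpha>)
  obtain w where w: "w \<in> lang_factor N p x" "w \<noteq> []" "e x = g w" using Cons.prems by auto
  show ?case
  proof (cases "\<alpha> = []")
    case False
    then obtain v where "v \<in> lang N p \<alpha>" "v \<noteq> []" "sprod f (map e \<alpha>) = g v"
      using Cons by auto
    then show ?thesis
      using w False hom by (intro bexI[of _ "w @ v"]) (simp_all add: sprod_Cons concI)
  qed (use w in auto)
qed simp

text \<open>By \<open>omega_power_eq_spow\<close> the value of a power is an ordinary power of the
  image of a single word \<open>w\<close>, with an exponent that the language admits. Here all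
  copies of the base use the same \<open>w\<close>, which is one of the permitted choices.\<close>

lemma eval_factor_in_lang:
  assumes S: "finite_semigroup S f" and range: "\<And>u. u \<noteq> [] \<Longrightarrow> g u \<in> S"
    and hom: "\<And>u v. u \<noteq> [] \<Longrightarrow> v \<noteq> [] \<Longrightarrow> g (u @ v) = f (g u) (g v)"
    and h: "\<And>a. h a = g [a]" and "p > 0"
  shows "wf_factor x \<Longrightarrow> \<exists>w\<in>lang_factor N p x. w \<noteq> [] \<and> eval_factor S f h x = g w"
proof (induction x)
  case (Pow \<delta> q)
  then obtain w where w: "w \<in> lang N p \<delta>" "w \<noteq> []" "sprod f (map (eval_factor S f h) \<delta>) = g w"
    using sprod_eval_in_lang[where g = g and f = f, OF hom, of \<delta> N p "eval_factor S f h"] by auto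
  interpret finite_semigroup_element S f "g w"
    using S range w(2) by unfold_locales
  obtain k where k: "k > 0" "f (spow f (g w) k) (spow f (g w) k) = spow f (g w) k"
    using ex_idem_spow by auto
  \<comment> \<open>In \<open>n\<close>, the factor \<open>k\<close> gives idempotency,
    \<open>p\<close> gives the congruence of \<open>2 * n + q\<close> to \<open>q\<close>, and
    \<open>t\<close> makes this exponent at least \<open>N\<close> and \<open>n\<close> larger than
    the absolute value of \<open>q\<close>.\<close>
  define t where "t = N + nat \<bar>q\<bar> + 1"
  define n where "n = k * (p * t)"
  have "spow f (g w) n = spow f (g w) k"
    unfolding n_def using k \<open>p > 0\<close> by (intro spow_idem_mult) (simp_all add: t_def)
  moreover have n: "n > 0" "t \<le> n"
    using k \<open>p > 0\<close> mult_le_mono[of 1 "k * p" t t] by (simp_all add: n_def t_def algebra_simps Suc_le_eq)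
  moreover from n have "\<bar>q\<bar> < int n" by (simp add: t_def)
  ultimately have eq: "omega_power S f (g w) q = spow f (g w) (nat (2 * int n + q))"
    using k by (intro omega_power_eq_spow) simp_all
  define m where "m = nat (2 * int n + q)"
  have m: "int m = 2 * int n + q" "m \<ge> N" "m > 0"
    using n by (auto simp: m_def t_def)
  have "int p dvd int m - q" using m by (simp add: n_def)
  have pow: "spow f (g w) i = g (concat (replicate i w))" if "i > 0" for i
    using that
  proof (induction i)
    case (Suc i)
    then show ?case
      using w(2) hom[of w "concat (replicate i w)"]
      by (cases "i = 0") (simp_all add: spow_def sprod_Cons)
  qed simp
  have "concat (replicate i w) \<in> lang N p (tpow \<delta> i)" for i
    using w(1) by (induction i) (simp_all add: lang_append concI)
  then have "concat (replicate m w) \<in> lang_factor N p (Pow \<delta> q)"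
    unfolding lang_factor_Pow using m \<open>int p dvd int m - q\<close> by blast
  moreover have "eval_factor S f h (Pow \<delta> q) = g (concat (replicate m w))"
    using w(3) eq pow m by (simp add: m_def)
  ultimately show ?case using m w(2) by (intro bexI[of _ "concat (replicate m w)"]) auto
qed (simp add: h)

text \<open>In a semigroup recognizing the language of \<alpha>, the values of the two terms are
  images of words \<open>u\<close> and \<open>v\<close> of their respective languages. Equal images
  put \<open>v\<close> into the language of \<alpha> as well.\<close>

lemma satisfied_imp_lang_meet:
  assumes "kterm \<alpha>" "kterm \<beta>" "all_finite_semigroups_satisfy \<alpha> \<beta>" "N > 0" "p > 0"
  obtains w where "w \<in> lang N p \<alpha>" "w \<in> lang N p \<beta>"
proof -
  obtain g :: "'a list \<Rightarrow> nat" where g: "finite (range g)"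
    "\<And>u u' v v'. g u = g u' \<Longrightarrow> g v = g v' \<Longrightarrow> g (u @ v) = g (u' @ v')"
    "\<And>u v. g u = g v \<Longrightarrow> u \<in> lang N p \<alpha> \<longleftrightarrow> v \<in> lang N p \<alpha>"
    using regular_recognized[OF regular_lang[OF assms(4,5), of \<alpha>]] by metis
  \<comment> \<open>Multiplication by representatives; it is well defined because \<open>g\<close>
    is compatible with concatenation.\<close>
  define f where "f x y = g (inv_into UNIV g x @ inv_into UNIV g y)" for x y
  have hom: "f (g u) (g v) = g (u @ v)" for u v
    unfolding f_def by (intro g(2)) (simp_all add: f_inv_into_f)
  have S: "finite_semigroup (range g) f"
    using g(1) by (auto simp: finite_semigroup_def hom)
  define h where "h a = g [a]" for a
  have "eval_term (range g) f h \<alpha> = eval_term (range g) f h \<beta>"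
    using assms(3) S unfolding all_finite_semigroups_satisfy_def satisfies_def
    by (metis h_def image_subsetI rangeI)
  moreover have "\<exists>w\<in>lang N p \<gamma>. w \<noteq> [] \<and> eval_term (range g) f h \<gamma> = g w"
    if "kterm \<gamma>" for \<gamma> :: "'a kterm"
    unfolding eval_term_def
  proof (rule sprod_eval_in_lang)
    fix x assume "x \<in> set \<gamma>"
    then have "wf_factor x" using that by (simp add: kterm_def kterm0_def)
    then show "\<exists>w\<in>lang_factor N p x. w \<noteq> [] \<and> eval_factor (range g) f h x = g w"
      using eval_factor_in_lang[OF S, of g h p x N] assms(5) by (simp add: hom h_def)
  qed (use that in \<open>simp_all add: hom kterm_def\<close>)
  ultimately obtain u v where "u \<in> lang N p \<alpha>" "v \<in> lang N p \<beta>" "g u = g v"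
    using assms(1,2) by metis
  then show thesis using g(3) that by blast
qed

section \<open>Overlaps of powers of Lyndon terms\<close>

lemma length_tpow [simp]: "length (tpow \<delta> n) = n * length \<delta>"
  by (induction n) simp_all

lemma le_length_tpow: "\<delta> \<noteq> [] \<Longrightarrow> n \<le> n * length \<delta>"
  by (cases \<delta>) simp_all

lemma tpow_Suc_right: "tpow \<delta> (Suc n) = tpow \<delta> n @ \<delta>"
  using tpow_add[of \<delta> n 1] by simp

lemma set_tpow_subset: "set (tpow \<delta> n) \<subseteq> set \<delta>"
  by (induction n) auto

lemma append_tpow_rotate: "\<beta> @ tpow (\<alpha> @ \<beta>) n = tpow (\<beta> @ \<alpha>) n @ \<beta>"
  by (induction n) simp_all

lemma kterm0_append [simp]: "kterm0 (\<alpha> @ \<beta>) \<longleftrightarrow> kterm0 \<alpha> \<and> kterm0 \<beta>"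
  by (auto simp: kterm0_def)

lemma lyndon_kterm: "lyndon \<alpha> \<Longrightarrow> kterm \<alpha>"
  by (simp add: lyndon_def primitive_term_def)

lemma lyndon_not_Nil: "lyndon \<alpha> \<Longrightarrow> \<alpha> \<noteq> []"
  by (simp add: lyndon_def primitive_term_def kterm_def)

lemma primitive_tpow_exponent:
  assumes "primitive_term (tpow \<delta> m)"
  shows "m = 1"
proof (rule ccontr)
  assume "m \<noteq> 1"
  have "tpow \<delta> m \<noteq> []" using assms by (simp add: primitive_term_def kterm_def)
  then obtain k where k: "m = Suc k" "k > 0" "\<delta> \<noteq> []"
    using \<open>m \<noteq> 1\<close> by (cases m; cases "\<delta> = []") (auto simp: tpow_def)
  then have "kterm \<delta>" using assms by (auto simp: primitive_term_def kterm_def)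
  moreover have "m > 1" using k by simp
  ultimately show False using assms unfolding primitive_term_def by blast
qed

lemma primitive_not_commute:
  assumes "primitive_term (\<alpha> @ \<beta>)" "\<alpha> \<noteq> []" "\<beta> \<noteq> []"
  shows "\<alpha> @ \<beta> \<noteq> \<beta> @ \<alpha>"
proof
  assume "\<alpha> @ \<beta> = \<beta> @ \<alpha>"
  then obtain n \<delta> where "n > 1" "\<alpha> @ \<beta> = tpow \<delta> n"
    using comm_append_is_replicate[OF assms(2,3)] unfolding tpow_def by metis
  then show False using primitive_tpow_exponent[of \<delta> n] assms(1) by simp
qed

lemma conjugate_of_tpow:
  assumes "\<beta> @ \<alpha> = tpow \<delta> m"
  obtains \<delta>' where "\<alpha> @ \<beta> = tpow \<delta>' m"
proof -
  have rotate1: "rotate1 (tpow \<gamma> m) = tpow (rotate1 \<gamma>) m" for \<gamma> :: "'a kterm"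
  proof (cases "\<gamma> = [] \<or> m = 0")
    case False
    then obtain x \<gamma>' k where "\<gamma> = [x] @ \<gamma>'" "m = Suc k"
      by (cases \<gamma>; cases m) auto
    then show ?thesis using append_tpow_rotate[of "[x]" \<gamma>' k]
      by (simp add: append_tpow_rotate[of "[x]"] flip: append_tpow_rotate[of \<gamma>' "[x]"])
  qed (auto simp: tpow_def)
  have "rotate n (tpow \<gamma> m) = tpow (rotate n \<gamma>) m" for n and \<gamma> :: "'a kterm"
    by (induction n) (simp_all add: rotate1)
  then have "\<alpha> @ \<beta> = tpow (rotate (length \<beta>) \<delta>) m"
    by (metis assms rotate_append)
  then show thesis by (rule that)
qed

lemma lyndon_conjugate_eq:
  assumes "lyndon (\<alpha> @ \<beta>)" "lyndon (\<beta> @ \<alpha>)"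
  shows "\<alpha> @ \<beta> = \<beta> @ \<alpha>"
proof -
  have "kterm0 \<alpha>" "kterm0 \<beta>"
    using lyndon_kterm[OF assms(1)] by (simp_all add: kterm_def)
  then have "conjugate (\<alpha> @ \<beta>) (\<beta> @ \<alpha>)" "conjugate (\<beta> @ \<alpha>) (\<alpha> @ \<beta>)"
    unfolding conjugate_def by blast+
  then have "word (\<alpha> @ \<beta>) = word (\<beta> @ \<alpha>)"
    using assms unfolding lyndon_def by (blast intro: lexordp_eq_antisym)
  then show ?thesis by (simp add: word_inject)
qed

text \<open>The Fine and Wilf argument: both periods can be read off at the beginning.\<close>

lemma powers_overlap_commute:
  assumes "tpow \<gamma> s @ \<alpha> = tpow \<delta> t @ \<beta>" "\<gamma> \<noteq> []" "\<delta> \<noteq> []" "length \<delta> < s" "length \<gamma> < t"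
  shows "\<gamma> @ \<delta> = \<delta> @ \<gamma>"
proof -
  \<comment> \<open>A long power of \<gamma> that begins with \<delta> also begins with
    \<gamma>\<delta>, as shifting by one copy of \<gamma> shows. Used in both directions, the same
    prefix reads \<gamma>\<delta> and \<delta>\<gamma>.\<close>
  have take: "take (length \<gamma> + length \<delta>) (tpow \<gamma> s @ \<alpha>) = \<gamma> @ \<delta>"
    if eq: "tpow \<gamma> s @ \<alpha> = \<delta> @ \<beta>" and ne: "\<gamma> \<noteq> []" and less: "length \<delta> < s" for \<gamma> \<delta> \<alpha> \<beta> :: "'a kterm" and s
  proof -
    obtain k where k: "s = Suc k" "length \<delta> \<le> k" using less by (cases s) auto
    have "length \<delta> \<le> length (tpow \<gamma> k)"
      using k(2) le_length_tpow[OF ne, of k] unfolding length_tpow by linarith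
    moreover have "tpow \<gamma> k @ \<gamma> @ \<alpha> = \<delta> @ \<beta>"
      using eq k by (simp add: tpow_Suc_right del: tpow_simps)
    ultimately obtain \<eta> where "tpow \<gamma> k = \<delta> @ \<eta>"
      by (metis prefixE prefixI prefix_length_prefix)
    then show ?thesis using k by simp
  qed
  obtain s' t' where "s = Suc s'" "t = Suc t'" using assms(4,5) by (cases s; cases t) auto
  then have "tpow \<gamma> s @ \<alpha> = \<delta> @ tpow \<delta> t' @ \<beta>" "tpow \<delta> t @ \<beta> = \<gamma> @ tpow \<gamma> s' @ \<alpha>"
    using assms(1) by (metis append_assoc tpow_simps(2))+
  from take[OF this(1) assms(2,4)] take[OF this(2) assms(3,5)]
  show ?thesis using assms(1) by (simp add: add.commute)
qed

text \<open>The power of \<open>\<alpha> @ \<beta>\<close> is read from inside a copy. Commutation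
  gives a common root, primitivity makes both exponents 1, and so \<delta> is a conjugate of
  \<open>\<alpha> @ \<beta>\<close>. Both are Lyndon and hence equal, and a primitive term has no
  nontrivial rotation equal to itself.\<close>

lemma lyndon_powers_overlap:
  assumes "lyndon (\<alpha> @ \<beta>)" "lyndon \<delta>" "\<beta> \<noteq> []"
    and "tpow (\<beta> @ \<alpha>) s @ \<zeta> = tpow \<delta> t @ \<eta>" "length \<delta> < s" "length (\<alpha> @ \<beta>) < t"
  shows "\<alpha> = [] \<and> \<beta> = \<delta>"
proof -
  have "(\<beta> @ \<alpha>) @ \<delta> = \<delta> @ (\<beta> @ \<alpha>)"
    using assms lyndon_not_Nil[OF assms(2)] by (intro powers_overlap_commute[OF assms(4)]) auto
  then obtain m n \<gamma> where \<gamma>: "\<beta> @ \<alpha> = tpow \<gamma> m" "\<delta> = tpow \<gamma> n"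
    using comm_append_are_replicate unfolding tpow_def by metis
  have prim: "primitive_term \<delta>" "primitive_term (\<alpha> @ \<beta>)" using assms by (simp_all add: lyndon_def)
  then have "\<delta> = \<gamma>" using primitive_tpow_exponent[of \<gamma> n] \<gamma> by simp
  moreover obtain \<gamma>' where "\<alpha> @ \<beta> = tpow \<gamma>' m" using conjugate_of_tpow[OF \<gamma>(1)] .
  then have "m = 1" using primitive_tpow_exponent[of \<gamma>' m] prim by simp
  ultimately have \<delta>: "\<delta> = \<beta> @ \<alpha>" using \<gamma> by simp
  then have "\<alpha> @ \<beta> = \<beta> @ \<alpha>" using lyndon_conjugate_eq assms by blast
  then have "\<alpha> = []" using primitive_not_commute prim assms(3) by blast
  then show ?thesis using \<delta> by simp
qed

lemma prefix_of_tpow: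
  assumes "\<xi> @ \<alpha> = tpow \<delta> s @ \<beta>" "length \<xi> < s * length \<delta>"
  obtains k \<delta>\<^sub>1 \<delta>\<^sub>2 where "\<xi> = tpow \<delta> k @ \<delta>\<^sub>1" "\<delta> = \<delta>\<^sub>1 @ \<delta>\<^sub>2" "\<delta>\<^sub>2 \<noteq> []"
proof -
  have "\<exists>k \<delta>\<^sub>1 \<delta>\<^sub>2. \<xi> = tpow \<delta> k @ \<delta>\<^sub>1 \<and> \<delta> = \<delta>\<^sub>1 @ \<delta>\<^sub>2 \<and> \<delta>\<^sub>2 \<noteq> []"
    using assms
  proof (induction s arbitrary: \<xi>)
    case (Suc s)
    then consider \<eta> where "\<xi> = \<delta> @ \<eta>" "\<eta> @ \<alpha> = tpow \<delta> s @ \<beta>" | \<eta> where "\<delta> = \<xi> @ \<eta>" "\<eta> \<noteq> []"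
      by (auto simp: append_eq_append_conv2) (metis append_Nil2)
    then show ?case
    proof cases
      case 1
      then obtain k \<delta>\<^sub>1 \<delta>\<^sub>2 where "\<eta> = tpow \<delta> k @ \<delta>\<^sub>1" "\<delta> = \<delta>\<^sub>1 @ \<delta>\<^sub>2" "\<delta>\<^sub>2 \<noteq> []"
        using Suc.IH[of \<eta>] Suc.prems by auto
      then show ?thesis using 1(1)
        by (intro exI[of _ "Suc k"] exI[of _ \<delta>\<^sub>1] exI[of _ \<delta>\<^sub>2]) simp
    next
      case 2
      then show ?thesis by (intro exI[of _ 0] exI[of _ \<xi>] exI[of _ \<eta>]) simp
    qed
  qed simp
  then show thesis using that by blast
qed

text \<open>Here \<xi> is the offset between the starts of the two powers. By the overlap lemma it
  ends at a boundary between copies of \<delta>, and \<delta> equals \<epsilon>. A nonempty offset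
  would then end with \<epsilon>, against the last assumption.\<close>

lemma lyndon_powers_aligned:
  assumes "lyndon \<delta>" "lyndon \<epsilon>" "length \<xi> \<le> M" "length \<delta> \<le> M" "length \<epsilon> \<le> M"
    and "s \<ge> 2 * M + 2" "t \<ge> 2 * M + 2" "\<xi> @ tpow \<epsilon> t @ \<beta> = tpow \<delta> s @ \<alpha>" "\<not> suffix \<epsilon> \<xi>"
  shows "\<xi> = [] \<and> \<delta> = \<epsilon>"
proof -
  have le: "n \<le> n * length \<delta>" for n
    using lyndon_not_Nil[OF assms(1)] by (rule le_length_tpow)
  have "length \<xi> < s * length \<delta>" using le[of s] assms(3,6) by linarith
  then obtain k \<delta>\<^sub>1 \<delta>\<^sub>2 where k: "\<xi> = tpow \<delta> k @ \<delta>\<^sub>1" "\<delta> = \<delta>\<^sub>1 @ \<delta>\<^sub>2" "\<delta>\<^sub>2 \<noteq> []"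
    using prefix_of_tpow[OF assms(8)] by metis
  have "k * length \<delta> \<le> length \<xi>" by (simp add: k(1))
  then have "k \<le> M" using le[of k] assms(3) by linarith
  \<comment> \<open>The complete copies of \<delta> after the one in which \<xi> ends. At most
    \<open>M\<close> copies precede that one, so \<open>2 * M + 2\<close> copies leave more than
    \<open>M\<close>.\<close>
  define r where "r = s - k - 1"
  have r: "s = k + Suc r" "M < r" using \<open>k \<le> M\<close> assms(6) by (auto simp: r_def)
  have "tpow \<delta> s @ \<alpha> = tpow \<delta> k @ \<delta>\<^sub>1 @ \<delta>\<^sub>2 @ tpow (\<delta>\<^sub>1 @ \<delta>\<^sub>2) r @ \<alpha>"
    unfolding r(1) tpow_add by (simp add: k(2))
  then have "tpow (\<delta>\<^sub>2 @ \<delta>\<^sub>1) r @ \<delta>\<^sub>2 @ \<alpha> = tpow \<epsilon> t @ \<beta>"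
    using assms(8) append_tpow_rotate[of \<delta>\<^sub>2 \<delta>\<^sub>1 r] by (simp add: k(1))
  then have "\<delta>\<^sub>1 = [] \<and> \<delta>\<^sub>2 = \<epsilon>"
    using assms k r by (intro lyndon_powers_overlap[of \<delta>\<^sub>1 \<delta>\<^sub>2 \<epsilon> r _ t]) auto
  moreover have "k = 0"
  proof (rule ccontr)
    assume "k \<noteq> 0"
    then obtain i where "k = Suc i" by (cases k) auto
    then have "suffix \<delta> (tpow \<delta> k)" unfolding \<open>k = Suc i\<close> tpow_Suc_right by (simp add: suffix_def)
    then show False using assms(9) k calculation by simp
  qed
  ultimately show ?thesis using k by simp
qed

lemma tpow_cancel:
  assumes "tpow \<delta> m @ \<alpha> = tpow \<delta> n @ \<beta>" "\<not> prefix \<delta> \<alpha>" "\<not> prefix \<delta> \<beta>"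
  shows "m = n \<and> \<alpha> = \<beta>"
  using assms(1)
proof (induction m arbitrary: n)
  case 0
  then show ?case using assms(2) by (cases n) auto
next
  case (Suc m)
  then show ?case using assms(3) by (cases n) auto
qed

section \<open>Expanding the powers of highest rank\<close>

lemma rank_factor_Pow: "rank_factor (Pow \<delta> q) = Suc (rank \<delta>)"
  by (simp add: rank_def)

declare rank_factor.simps(2) [simp del]

lemma rank_le_iff: "rank \<alpha> \<le> j \<longleftrightarrow> (\<forall>x\<in>set \<alpha>. rank_factor x \<le> j)"
  by (auto simp: rank_def)

lemma rank_factor_le_rank: "x \<in> set \<alpha> \<Longrightarrow> rank_factor x \<le> rank \<alpha>"
  using rank_le_iff by blast

lemma rank_attained:
  assumes "rank \<alpha> > 0"
  obtains x where "x \<in> set \<alpha>" "rank_factor x = rank \<alpha>"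
proof -
  have "rank \<alpha> \<in> insert 0 (set (map rank_factor \<alpha>))"
    unfolding rank_def by (rule Max_in) simp_all
  then show thesis using assms that by auto
qed

text \<open>A relation, since each occurrence chooses its exponent independently. Powers inside the
  bases stay untouched, so that the language of a term can be unfolded one rank at a time.\<close>

inductive expands :: "nat \<Rightarrow> nat \<Rightarrow> nat \<Rightarrow> 'a kterm \<Rightarrow> 'a kterm \<Rightarrow> bool" for j N p where
  expands_Nil: "expands j N p [] []"
| expands_low: "expands j N p (x # \<alpha>) (x # \<alpha>')"
    if "rank_factor x \<le> j" "expands j N p \<alpha> \<alpha>'"
| expands_Pow: "expands j N p (Pow \<delta> q # \<alpha>) (tpow \<delta> m @ \<alpha>')"
    if "rank \<delta> = j" "m \<ge> N" "int p dvd int m - q" "expands j N p \<alpha> \<alpha>'"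

lemma expands_rank:
  assumes "expands j N p \<alpha> \<alpha>'"
  shows "rank \<alpha>' \<le> j"
  using assms
  by induction (use set_tpow_subset in \<open>fastforce simp: rank_le_iff rank_factor_le_rank\<close>)+

lemma lang_expands:
  assumes "w \<in> lang N p \<alpha>" "rank \<alpha> \<le> Suc j"
  obtains \<alpha>' where "expands j N p \<alpha> \<alpha>'" "w \<in> lang N p \<alpha>'"
proof -
  have "\<exists>\<alpha>'. expands j N p \<alpha> \<alpha>' \<and> w \<in> lang N p \<alpha>'"
    using assms
  proof (induction \<alpha> arbitrary: w)
    case Nil
    then show ?case using expands_Nil by force
  next
    case (Cons x \<alpha>)
    then obtain u v where uv: "w = u @ v" "u \<in> lang_factor N p x" "v \<in> lang N p \<alpha>"
      by (auto simp: conc_def)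
    then obtain \<alpha>' where \<alpha>': "expands j N p \<alpha> \<alpha>'" "v \<in> lang N p \<alpha>'"
      using Cons by (auto simp: rank_le_iff)
    show ?case
    proof (cases "rank_factor x \<le> j")
      case True
      then show ?thesis using \<alpha>' uv
        by (intro exI[of _ "x # \<alpha>'"]) (simp add: expands_low concI)
    next
      case False
      then have "rank_factor x = Suc j" using Cons.prems(2) by (auto simp: rank_le_iff)
      then obtain \<delta> q where x: "x = Pow \<delta> q" "rank \<delta> = j"
        by (cases x) (auto simp: rank_factor_Pow)
      then obtain m where "m \<ge> N" "int p dvd int m - q" "u \<in> lang N p (tpow \<delta> m)"
        using uv by (auto simp: lang_factor_Pow simp del: lang_factor.simps)
      then show ?thesis using \<alpha>' uv x
        by (intro exI[of _ "tpow \<delta> m @ \<alpha>'"]) (simp add: expands_Pow lang_append concI)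
    qed
  qed
  then show thesis using that by blast
qed

text \<open>
  Beyond the bounds given by \<open>M\<close>, the conditions on the canonical forms of rank \<open>j + 1\<close> forbid
  certain contiguous subterms. None of these has a power of rank \<open>j + 1\<close> in its interior, so none
  can be created by repeating a factor that contains such a power.
\<close>

definition forbidden :: "nat \<Rightarrow> nat \<Rightarrow> 'a::linorder kterm \<Rightarrow> bool" where
  "forbidden j M \<xi> \<longleftrightarrow>
     (\<exists>\<delta> q. \<xi> = [Pow \<delta> q] \<and> rank \<delta> = j \<and> \<not> (lyndon \<delta> \<and> length \<delta> \<le> M \<and> \<bar>q\<bar> \<le> int M)) \<or>
     (\<exists>\<delta> q. rank \<delta> = j \<and> (\<xi> = \<delta> @ [Pow \<delta> q] \<or> \<xi> = Pow \<delta> q # \<delta>)) \<or>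
     (\<exists>\<delta> q \<gamma> \<epsilon> r l. \<xi> = Pow \<delta> q # \<gamma> @ [Pow \<epsilon> r] \<and> rank \<delta> = j \<and> rank \<epsilon> = j \<and> rank \<gamma> \<le> j \<and>
        prefix \<delta> (\<gamma> @ tpow \<epsilon> l)) \<or>
     (length \<xi> > M \<and> rank \<xi> \<le> j)"

definition locally_canonical :: "nat \<Rightarrow> nat \<Rightarrow> 'a::linorder kterm \<Rightarrow> bool" where
  "locally_canonical j M \<alpha> \<longleftrightarrow> (\<forall>\<xi>. sublist \<xi> \<alpha> \<longrightarrow> \<not> forbidden j M \<xi>)"

lemma locally_canonical_sublist:
  "locally_canonical j M \<alpha> \<Longrightarrow> sublist \<beta> \<alpha> \<Longrightarrow> locally_canonical j M \<beta>"
  unfolding locally_canonical_def by (meson sublist_order.order_trans)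

lemma locally_canonicalD:
  "locally_canonical j M (\<alpha> @ \<xi> @ \<beta>) \<Longrightarrow> \<not> forbidden j M \<xi>"
  unfolding locally_canonical_def by simp

lemma expands_first_power:
  assumes "expands j N p \<alpha> w"
  shows "(w = \<alpha> \<and> rank \<alpha> \<le> j) \<or> (\<exists>\<gamma> \<delta> q \<alpha>' m w'. \<alpha> = \<gamma> @ Pow \<delta> q # \<alpha>' \<and> w = \<gamma> @ tpow \<delta> m @ w' \<and>
    rank \<gamma> \<le> j \<and> rank \<delta> = j \<and> m \<ge> N \<and> int p dvd int m - q \<and> expands j N p \<alpha>' w')"
  (is "_ \<or> ?P \<alpha> w")
  using assms
proof induction
  case expands_Nil
  then show ?case by (simp add: rank_def)
next
  case (expands_low x \<alpha> w)
  from expands_low.IH show ?case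
  proof
    assume "?P \<alpha> w"
    then obtain \<gamma> \<delta> q \<alpha>' m w' where "\<alpha> = \<gamma> @ Pow \<delta> q # \<alpha>'" "w = \<gamma> @ tpow \<delta> m @ w'"
      "rank \<gamma> \<le> j" "rank \<delta> = j" "m \<ge> N" "int p dvd int m - q" "expands j N p \<alpha>' w'"
      by blast
    then have "?P (x # \<alpha>) (x # w)"
      using expands_low.hyps
      by (intro exI[of _ "x # \<gamma>"] exI[of _ \<delta>] exI[of _ q] exI[of _ \<alpha>'] exI[of _ m] exI[of _ w'])
        (simp add: rank_le_iff)
    then show ?thesis by blast
  qed (use expands_low.hyps in \<open>simp add: rank_le_iff\<close>)
next
  case (expands_Pow \<delta> m q \<alpha> w)
  then show ?case
    by (intro disjI2 exI[of _ "[]"] exI[of _ \<delta>] exI[of _ q] exI[of _ \<alpha>] exI[of _ m] exI[of _ w])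
      (simp add: rank_def)
qed

text \<open>Turns the absence of forbidden subterms in \<alpha> into conditions on the expansion
  \<open>w\<close>, around its first expanded power, that do not mention \<alpha>.\<close>

lemma expands_cases:
  assumes exp: "expands j N p \<alpha> w" and loc: "locally_canonical j M \<alpha>" and "M < N"
  obtains "w = \<alpha>" "length w \<le> M"
  | \<gamma> \<delta> q m \<alpha>' w' where "\<alpha> = \<gamma> @ Pow \<delta> q # \<alpha>'" "w = \<gamma> @ tpow \<delta> m @ w'"
    "length \<gamma> \<le> M" "lyndon \<delta>" "length \<delta> \<le> M" "\<bar>q\<bar> \<le> int M" "\<not> suffix \<delta> \<gamma>" "\<not> prefix \<delta> w'"
    "m \<ge> N" "int p dvd int m - q" "expands j N p \<alpha>' w'" "locally_canonical j M \<alpha>'"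
  using expands_first_power[OF exp]
proof (elim disjE conjE exE)
  assume w: "w = \<alpha>" "rank \<alpha> \<le> j"
  then have "length w \<le> M"
    using locally_canonicalD[of j M "[]" \<alpha> "[]"] loc by (auto simp: forbidden_def)
  then show thesis using w that(1) by blast
next
  fix \<gamma> \<delta> q \<alpha>' m w'
  assume \<alpha>: "\<alpha> = \<gamma> @ Pow \<delta> q # \<alpha>'" and w: "w = \<gamma> @ tpow \<delta> m @ w'" and ranks: "rank \<gamma> \<le> j" "rank \<delta> = j"
    and m: "m \<ge> N" "int p dvd int m - q" and exp': "expands j N p \<alpha>' w'"
  have "length \<gamma> \<le> M"
    using locally_canonicalD[of j M "[]" \<gamma> "Pow \<delta> q # \<alpha>'"] loc \<alpha> ranks by (auto simp: forbidden_def)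
  moreover have \<delta>: "lyndon \<delta> \<and> length \<delta> \<le> M \<and> \<bar>q\<bar> \<le> int M"
    using locally_canonicalD[of j M \<gamma> "[Pow \<delta> q]" \<alpha>'] loc \<alpha> ranks by (auto simp: forbidden_def)
  moreover have "\<not> suffix \<delta> \<gamma>"
  proof
    assume "suffix \<delta> \<gamma>"
    then obtain \<gamma>' where "\<gamma> = \<gamma>' @ \<delta>" by (auto simp: suffix_def)
    then show False
      using locally_canonicalD[of j M \<gamma>' "\<delta> @ [Pow \<delta> q]" \<alpha>'] loc \<alpha> ranks by (auto simp: forbidden_def)
  qed
  \<comment> \<open>The rest \<open>w'\<close> may reach into the next expanded power. That power
    alone has more than \<open>M\<close> factors, so \<delta> cannot extend beyond it, and the
    pattern excluded by (cf.4) would occur in \<alpha>.\<close>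
  moreover have "\<not> prefix \<delta> w'"
  proof
    assume pre: "prefix \<delta> w'"
    have no: "\<not> prefix \<delta> \<alpha>'"
    proof
      assume "prefix \<delta> \<alpha>'"
      then obtain \<alpha>'' where "\<alpha>' = \<delta> @ \<alpha>''" by (auto simp: prefix_def)
      then show False
        using locally_canonicalD[of j M \<gamma> "Pow \<delta> q # \<delta>" \<alpha>''] loc \<alpha> ranks by (auto simp: forbidden_def)
    qed
    show False
      using expands_first_power[OF exp']
    proof (elim disjE conjE exE)
      assume "w' = \<alpha>'"
      then show False using pre no by simp
    next
      fix \<gamma>' \<epsilon> r \<beta> k v
      assume \<alpha>': "\<alpha>' = \<gamma>' @ Pow \<epsilon> r # \<beta>" and w': "w' = \<gamma>' @ tpow \<epsilon> k @ v"
        and ranks': "rank \<gamma>' \<le> j" "rank \<epsilon> = j" and "k \<ge> N"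
      have "lyndon \<epsilon>"
        using locally_canonicalD[of j M "\<gamma> @ Pow \<delta> q # \<gamma>'" "[Pow \<epsilon> r]" \<beta>] loc \<alpha> \<alpha>' ranks'
        by (auto simp: forbidden_def)
      then have "k \<le> k * length \<epsilon>" by (intro le_length_tpow lyndon_not_Nil)
      then have "length \<delta> \<le> length (\<gamma>' @ tpow \<epsilon> k)"
        using \<delta> \<open>k \<ge> N\<close> \<open>M < N\<close> unfolding length_append length_tpow by linarith
      then have "prefix \<delta> (\<gamma>' @ tpow \<epsilon> k)"
        using pre w' by (metis append_assoc prefixI prefix_length_prefix)
      then have "forbidden j M (Pow \<delta> q # \<gamma>' @ [Pow \<epsilon> r])"
        using ranks ranks' unfolding forbidden_def by blast
      then show False
        using locally_canonicalD[of j M \<gamma> "Pow \<delta> q # \<gamma>' @ [Pow \<epsilon> r]" \<beta>] loc \<alpha> \<alpha>' by simp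
    qed
  qed
  moreover have "locally_canonical j M \<alpha>'"
    using locally_canonical_sublist[OF loc, of \<alpha>'] \<alpha>
    by (metis append_Cons append_Nil sublist_appendI append_assoc append_Nil2)
  ultimately show thesis using that(2)[OF \<alpha> w] m exp' by blast
qed

text \<open>The first expanded powers of the two readings of \<open>w\<close> start at the same
  place and have the same base. Neither can be continued by its base, so they also have the same
  exponent, and the induction proceeds with the rest.\<close>

lemma expands_injective:
  assumes "expands j N p \<alpha> w" "expands j N p \<beta> w" "locally_canonical j M \<alpha>" "locally_canonical j M \<beta>"
    and N: "N \<ge> 2 * M + 2" and p: "p > 2 * M"
  shows "\<alpha> = \<beta>"
  using assms(1-4)
proof (induction "length \<alpha>" arbitrary: \<alpha> \<beta> w rule: less_induct)
  case less
  have "M < N" using N by simp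
  \<comment> \<open>Separates the two cases of \<open>expands_cases\<close>: either both readings
    contain an expanded power or neither does.\<close>
  have long: "length w > M" if "w = \<gamma> @ tpow \<delta> m @ w'" "lyndon \<delta>" "m \<ge> N"
    for \<gamma> \<delta> w' :: "'a kterm" and m
  proof -
    have "m \<le> m * length \<delta>" using that(2) by (intro le_length_tpow lyndon_not_Nil)
    then show ?thesis using that(3) \<open>M < N\<close> unfolding that(1) length_append length_tpow by linarith
  qed
  have aligned: "\<gamma>\<^sub>1 = \<gamma>\<^sub>2 \<and> \<delta>\<^sub>1 = \<delta>\<^sub>2"
    if eq: "\<gamma>\<^sub>1 @ tpow \<delta>\<^sub>1 m\<^sub>1 @ w\<^sub>1 = \<gamma>\<^sub>2 @ tpow \<delta>\<^sub>2 m\<^sub>2 @ w\<^sub>2" "length \<gamma>\<^sub>1 \<le> length \<gamma>\<^sub>2"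
      and lyn: "lyndon \<delta>\<^sub>1" "lyndon \<delta>\<^sub>2" "length \<delta>\<^sub>1 \<le> M" "length \<delta>\<^sub>2 \<le> M" "length \<gamma>\<^sub>2 \<le> M"
      and suf: "\<not> suffix \<delta>\<^sub>2 \<gamma>\<^sub>2" "m\<^sub>1 \<ge> N" "m\<^sub>2 \<ge> N"
    for \<gamma>\<^sub>1 \<gamma>\<^sub>2 \<delta>\<^sub>1 \<delta>\<^sub>2 w\<^sub>1 w\<^sub>2 :: "'a kterm" and m\<^sub>1 m\<^sub>2
  proof -
    obtain \<xi> where "\<gamma>\<^sub>2 = \<gamma>\<^sub>1 @ \<xi>"
      using eq by (metis prefixE prefixI prefix_length_prefix)
    with eq have \<xi>: "\<gamma>\<^sub>2 = \<gamma>\<^sub>1 @ \<xi>" "\<xi> @ tpow \<delta>\<^sub>2 m\<^sub>2 @ w\<^sub>2 = tpow \<delta>\<^sub>1 m\<^sub>1 @ w\<^sub>1"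
      by simp_all
    then have "\<not> suffix \<delta>\<^sub>2 \<xi>" using suf(1) by (auto simp: suffix_def)
    then have "\<xi> = [] \<and> \<delta>\<^sub>1 = \<delta>\<^sub>2"
      using lyn suf \<xi> N by (intro lyndon_powers_aligned[of \<delta>\<^sub>1 \<delta>\<^sub>2 \<xi> M m\<^sub>1 m\<^sub>2 w\<^sub>2 w\<^sub>1]) auto
    then show ?thesis using \<xi> by simp
  qed
  from less.prems(1,3) \<open>M < N\<close> show ?case
  proof (cases rule: expands_cases)
    case \<alpha>: 1
    from less.prems(2,4) \<open>M < N\<close> show ?thesis
    proof (cases rule: expands_cases)
      case 1
      then show ?thesis using \<alpha> by simp
    next
      case 2
      then show ?thesis using \<alpha> long by fastforce
    qed
  next
    case \<alpha>: (2 \<gamma>\<^sub>1 \<delta>\<^sub>1 q\<^sub>1 m\<^sub>1 \<alpha>' w\<^sub>1)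
    from less.prems(2,4) \<open>M < N\<close> show ?thesis
    proof (cases rule: expands_cases)
      case 1
      then show ?thesis using \<alpha> long by fastforce
    next
      case \<beta>: (2 \<gamma>\<^sub>2 \<delta>\<^sub>2 q\<^sub>2 m\<^sub>2 \<beta>' w\<^sub>2)
      have "\<gamma>\<^sub>1 = \<gamma>\<^sub>2 \<and> \<delta>\<^sub>1 = \<delta>\<^sub>2"
      proof (cases "length \<gamma>\<^sub>1 \<le> length \<gamma>\<^sub>2")
        case True
        then show ?thesis using \<alpha> \<beta> by (intro aligned[of \<gamma>\<^sub>1 \<delta>\<^sub>1 m\<^sub>1 w\<^sub>1 \<gamma>\<^sub>2 \<delta>\<^sub>2 m\<^sub>2 w\<^sub>2]) simp_all
      next
        case False
        then have "\<gamma>\<^sub>2 = \<gamma>\<^sub>1 \<and> \<delta>\<^sub>2 = \<delta>\<^sub>1" using \<alpha> \<beta> by (intro aligned[of \<gamma>\<^sub>2 \<delta>\<^sub>2 m\<^sub>2 w\<^sub>2 \<gamma>\<^sub>1 \<delta>\<^sub>1 m\<^sub>1 w\<^sub>1]) simp_all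
        then show ?thesis by simp
      qed
      moreover from this have "m\<^sub>1 = m\<^sub>2 \<and> w\<^sub>1 = w\<^sub>2"
        using \<alpha> \<beta> by (intro tpow_cancel[of \<delta>\<^sub>1]) auto
      moreover from this have "int p dvd q\<^sub>1 - q\<^sub>2"
        using dvd_diff[OF \<open>int p dvd int m\<^sub>2 - q\<^sub>2\<close> \<open>int p dvd int m\<^sub>1 - q\<^sub>1\<close>] by simp
      \<comment> \<open>Both numbers are at most \<open>M\<close> in absolute value, and they are
        congruent modulo \<open>p > 2 * M\<close>.\<close>
      then have "q\<^sub>1 = q\<^sub>2"
        using \<alpha>(6) \<beta>(6) p zdvd_not_zless[of "\<bar>q\<^sub>1 - q\<^sub>2\<bar>" "int p"] by fastforce
      moreover have "\<alpha>' = \<beta>'"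
        using \<alpha> \<beta> calculation by (intro less.hyps[of \<alpha>' w\<^sub>1 \<beta>']) simp_all
      ultimately show ?thesis using \<alpha>(1) \<beta>(1) by simp
    qed
  qed
qed

section \<open>Canonical forms are hereditarily locally canonical\<close>

text \<open>The replacement made in (cf.1), given factor by factor so that it distributes over
  concatenation.\<close>

definition square_factor :: "nat \<Rightarrow> 'a factor \<Rightarrow> 'a kterm" where
  "square_factor j x = (case x of Pow \<delta> q \<Rightarrow> if rank \<delta> = j then \<delta> @ \<delta> else [x] | Letter a \<Rightarrow> [x])"

definition square :: "nat \<Rightarrow> 'a kterm \<Rightarrow> 'a kterm" where
  "square j \<alpha> = concat (map (square_factor j) \<alpha>)"

lemma square_simps [simp]:
  "square j [] = []" "square j (x # \<alpha>) = square_factor j x @ square j \<alpha>"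
  "square j (\<alpha> @ \<beta>) = square j \<alpha> @ square j \<beta>"
  by (simp_all add: square_def)

lemma square_factor_low: "rank_factor x \<le> j \<Longrightarrow> square_factor j x = [x]"
  by (cases x) (auto simp: square_factor_def rank_factor_Pow)

lemma square_low: "rank \<alpha> \<le> j \<Longrightarrow> square j \<alpha> = \<alpha>"
  by (induction \<alpha>) (auto simp: rank_le_iff square_factor_low)

text \<open>One bound \<open>M\<close> serves all ranks. The rank of the term need not be
  \<open>j\<close>, so terms of different ranks can be treated at a common level.\<close>

primrec hereditarily_canonical :: "nat \<Rightarrow> nat \<Rightarrow> 'a::linorder kterm \<Rightarrow> bool" where
  "hereditarily_canonical M 0 \<alpha> \<longleftrightarrow> True"
| "hereditarily_canonical M (Suc j) \<alpha> \<longleftrightarrow>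
     locally_canonical j M \<alpha> \<and> hereditarily_canonical M j (square j \<alpha>)"

text \<open>Applied below to the middle one of three consecutive copies: a subterm either avoids one
  of the sides or has the whole middle copy strictly inside.\<close>

lemma sublist_append3_cases:
  assumes "sublist \<xi> (\<alpha> @ \<delta> @ \<beta>)"
  obtains "sublist \<xi> (\<alpha> @ \<delta>)" | "sublist \<xi> (\<delta> @ \<beta>)"
  | \<alpha>' \<beta>' where "\<xi> = \<alpha>' @ \<delta> @ \<beta>'" "\<alpha>' \<noteq> []" "\<beta>' \<noteq> []"
proof -
  obtain \<mu> \<rho> where eq: "\<alpha> @ \<delta> @ \<beta> = \<mu> @ \<xi> @ \<rho>" using assms by (auto simp: sublist_def)
  consider "length \<alpha> \<le> length \<mu>" | "length \<beta> \<le> length \<rho>"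
    | "length \<mu> < length \<alpha>" "length \<rho> < length \<beta>" by linarith
  then show thesis
  proof cases
    case 1
    then obtain \<mu>' where "\<mu> = \<alpha> @ \<mu>'" using eq by (metis prefixE prefixI prefix_length_prefix)
    then have "\<delta> @ \<beta> = \<mu>' @ \<xi> @ \<rho>" using eq by simp
    then show thesis by (intro that(2)) simp
  next
    case 2
    then obtain \<rho>' where "\<rho> = \<rho>' @ \<beta>" using eq
      by (metis append_assoc suffixE suffixI suffix_length_suffix)
    then have "\<alpha> @ \<delta> = \<mu> @ \<xi> @ \<rho>'" using eq by simp
    then show thesis by (intro that(1)) simp
  next
    case 3
    then obtain \<alpha>' where \<alpha>': "\<alpha> = \<mu> @ \<alpha>'"
      using eq by (metis prefixE prefixI prefix_length_prefix less_imp_le)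
    obtain \<beta>' where \<beta>': "\<beta> = \<beta>' @ \<rho>"
      using eq 3 by (metis append_assoc suffixE suffixI suffix_length_suffix less_imp_le)
    show thesis using eq 3 \<alpha>' \<beta>' by (intro that(3)[of \<alpha>' \<beta>']) auto
  qed
qed

lemma forbidden_interior:
  assumes "forbidden j M \<xi>" "x \<in> set (tl (butlast \<xi>))"
  shows "rank_factor x \<le> j"
proof -
  have tl: "y \<in> set (tl ys) \<Longrightarrow> y \<in> set ys" for y and ys :: "'a kterm" by (cases ys) auto
  have low: "y \<in> set \<zeta> \<Longrightarrow> rank \<zeta> \<le> j \<Longrightarrow> rank_factor y \<le> j" for y and \<zeta> :: "'a kterm"
    by (simp add: rank_le_iff)
  from assms(1) show ?thesis
    unfolding forbidden_def
  proof (elim disjE exE conjE)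
    fix \<delta> q assume "\<xi> = [Pow \<delta> q]"
    then show ?thesis using assms(2) by simp
  next
    fix \<delta> q assume "rank \<delta> = j" "\<xi> = \<delta> @ [Pow \<delta> q]"
    then show ?thesis using assms(2) by (intro low[of x \<delta>]) (simp_all add: tl)
  next
    fix \<delta> q assume "rank \<delta> = j" "\<xi> = Pow \<delta> q # \<delta>"
    then show ?thesis using assms(2)
      by (intro low[of x \<delta>]) (auto split: if_splits dest: in_set_butlastD)
  next
    fix \<delta> q \<gamma> \<epsilon> r l assume "\<xi> = Pow \<delta> q # \<gamma> @ [Pow \<epsilon> r]" "rank \<gamma> \<le> j"
    then show ?thesis using assms(2) by (intro low[of x \<gamma>]) (simp_all add: butlast_append)
  next
    assume "rank \<xi> \<le> j"
    then show ?thesis using assms(2) by (intro low[of x \<xi>]) (auto dest!: tl in_set_butlastD)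
  qed
qed

text \<open>A subterm of the longer term already occurs in the shorter one, unless it has the middle
  copy of \<delta> in its interior. In that case its interior contains a factor of rank
  \<open>j\<close>, which \<open>forbidden_interior\<close> excludes for forbidden subterms at the
  level below.\<close>

lemma hereditarily_canonical_pump:
  assumes "hereditarily_canonical M j (\<alpha> @ \<delta> @ \<delta> @ \<beta>)"
    and "j > 0 \<Longrightarrow> \<exists>x\<in>set \<delta>. rank_factor x = j"
  shows "hereditarily_canonical M j (\<alpha> @ \<delta> @ \<delta> @ \<delta> @ \<beta>)"
  using assms
proof (induction j arbitrary: \<alpha> \<delta> \<beta>)
  case (Suc j)
  then obtain x where x: "x \<in> set \<delta>" "rank_factor x = Suc j" by blast
  from x(2) obtain \<epsilon> q where \<epsilon>: "x = Pow \<epsilon> q" "rank \<epsilon> = j" by (cases x) (auto simp: rank_factor_Pow)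
  have "locally_canonical j M (\<alpha> @ \<delta> @ \<delta> @ \<delta> @ \<beta>)"
    unfolding locally_canonical_def
  proof (intro allI impI)
    fix \<xi> assume "sublist \<xi> (\<alpha> @ \<delta> @ \<delta> @ \<delta> @ \<beta>)"
    then have "sublist \<xi> ((\<alpha> @ \<delta>) @ \<delta> @ (\<delta> @ \<beta>))" by simp
    then show "\<not> forbidden j M \<xi>"
    proof (cases rule: sublist_append3_cases)
      case 1
      then have "sublist \<xi> (\<alpha> @ \<delta> @ \<delta> @ \<beta>)"
        by (metis append_assoc sublist_append_rightI sublist_order.order_trans)
      then show ?thesis using Suc.prems(1) by (simp add: locally_canonical_def)
    next
      case 2
      then have "sublist \<xi> (\<alpha> @ \<delta> @ \<delta> @ \<beta>)"
        by (metis sublist_append_leftI sublist_order.order_trans)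
      then show ?thesis using Suc.prems(1) by (simp add: locally_canonical_def)
    next
      case (3 \<alpha>' \<beta>')
      then have "x \<in> set (tl (butlast \<xi>))" using x by (simp add: butlast_append)
      then show ?thesis using forbidden_interior x by fastforce
    qed
  qed
  \<comment> \<open>The hypothesis on \<delta> passes to the lower rank: squaring exposes the base
    \<epsilon>, which has a factor of its own rank.\<close>
  moreover have "\<exists>y\<in>set (square j \<delta>). rank_factor y = j" if "j > 0"
  proof -
    obtain y where y: "y \<in> set \<epsilon>" "rank_factor y = j" using rank_attained[of \<epsilon>] \<epsilon> \<open>j > 0\<close> by blast
    then have "y \<in> set (square_factor j x)" using \<epsilon> by (simp add: square_factor_def)
    then show ?thesis using y x by (auto simp: square_def)
  qed
  then have "hereditarily_canonical M j (square j (\<alpha> @ \<delta> @ \<delta> @ \<delta> @ \<beta>))"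
    using Suc.prems(1) by (simp add: Suc.IH)
  ultimately show ?case by simp
qed simp

lemma hereditarily_canonical_tpow:
  assumes "hereditarily_canonical M j (\<alpha> @ \<delta> @ \<delta> @ \<beta>)" "rank \<delta> = j" "m \<ge> 2"
  shows "hereditarily_canonical M j (\<alpha> @ tpow \<delta> m @ \<beta>)"
  using assms(3)
proof (induction m rule: dec_induct)
  case base
  then show ?case using assms(1) by (simp add: numeral_2_eq_2)
next
  case (step m)
  then obtain k where k: "m = Suc (Suc k)" by (auto dest: le_Suc_ex)
  have "hereditarily_canonical M j (\<alpha> @ \<delta> @ \<delta> @ tpow \<delta> k @ \<beta>)" using step.IH k by simp
  then have "hereditarily_canonical M j (\<alpha> @ \<delta> @ \<delta> @ \<delta> @ tpow \<delta> k @ \<beta>)"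
    using assms(2) by (intro hereditarily_canonical_pump) (auto elim: rank_attained)
  then show ?case by (simp add: k)
qed

text \<open>Squares can be pumped to arbitrary larger powers without changing \<open>M\<close>. This
  is why the bounds depend on the canonical form only.\<close>

lemma hereditarily_canonical_expands:
  assumes "expands j N p \<alpha> \<alpha>'" "hereditarily_canonical M (Suc j) \<alpha>" "N \<ge> 2"
  shows "hereditarily_canonical M j \<alpha>'"
proof -
  \<comment> \<open>The powers are treated from left to right: \<beta> is already expanded, while
    the remainder is still squared.\<close>
  have "hereditarily_canonical M j (\<beta> @ square j \<alpha>) \<Longrightarrow> hereditarily_canonical M j (\<beta> @ \<alpha>')" for \<beta>
    using assms(1)
  proof (induction arbitrary: \<beta>)
    case (expands_low x \<alpha> \<alpha>')
    then show ?case using expands_low.IH[of "\<beta> @ [x]"] by (simp add: square_factor_low)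
  next
    case (expands_Pow \<delta> m q \<alpha> \<alpha>')
    then have "hereditarily_canonical M j (\<beta> @ tpow \<delta> m @ square j \<alpha>)"
      using assms(3) by (intro hereditarily_canonical_tpow) (simp_all add: square_factor_def)
    then show ?case using expands_Pow.IH[of "\<beta> @ tpow \<delta> m"] by simp
  qed simp
  from this[of "[]"] show ?thesis using assms(2) by simp
qed

text \<open>There is no power with a base of rank \<open>j\<close>, so only the length bound could
  be violated, and squaring at this rank does nothing.\<close>

lemma hereditarily_canonical_Suc:
  assumes "hereditarily_canonical M j \<alpha>" "rank \<alpha> \<le> j" "length \<alpha> \<le> M"
  shows "hereditarily_canonical M (Suc j) \<alpha>"
proof -
  have "\<not> forbidden j M \<xi>" if "sublist \<xi> \<alpha>" for \<xi>
  proof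
    have "set \<xi> \<subseteq> set \<alpha>" using that by (rule set_mono_sublist)
    then have "Pow \<delta> q \<in> set \<xi> \<Longrightarrow> rank \<delta> \<noteq> j" for \<delta> q
      using assms(2) rank_le_iff[of \<alpha> j] by (fastforce simp: rank_factor_Pow)
    moreover assume "forbidden j M \<xi>"
    ultimately show False
      using sublist_length_le[OF that] assms(3) unfolding forbidden_def by fastforce
  qed
  then show ?thesis using assms(1,2) by (simp add: locally_canonical_def square_low)
qed

section \<open>From the conditions on canonical forms to the absence of forbidden subterms\<close>

lemma first_high_factor:
  assumes "\<gamma> @ x # \<alpha> = \<beta> @ y # \<beta>'" "rank \<gamma> \<le> i" "rank_factor y = Suc i"
  shows "(\<beta> = \<gamma> \<and> x = y \<and> \<alpha> = \<beta>') \<or> (\<exists>\<eta>. \<beta> = \<gamma> @ x # \<eta> \<and> \<alpha> = \<eta> @ y # \<beta>')"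
proof -
  from assms(1) obtain \<eta> where "\<gamma> = \<beta> @ \<eta> \<and> \<eta> @ x # \<alpha> = y # \<beta>' \<or> \<gamma> @ \<eta> = \<beta> \<and> x # \<alpha> = \<eta> @ y # \<beta>'"
    unfolding append_eq_append_conv2 by blast
  moreover have "y \<notin> set \<gamma>" using assms(2,3) by (auto simp: rank_le_iff)
  ultimately show ?thesis by (cases \<eta>) auto
qed

text \<open>Every occurrence of a power with a base of rank \<open>i\<close> is one of the powers of
  the factorization. The clause on \<eta> says that \<open>\<gamma> (k - 1)\<close> reaches back to
  the preceding such power or to the beginning. The lower index \<open>a\<close> varies so that the
  induction can drop leading blocks.\<close>

lemma factorization_at:
  assumes "\<gamma> (a - 1) @ concat (map (\<lambda>k. [Pow (\<delta> k) (q k)] @ \<gamma> k) [a..<b]) = \<beta> @ Pow \<epsilon> r # \<beta>'"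
    and "\<forall>k\<in>{a - 1..<b}. rank (\<gamma> k) \<le> i" "\<forall>k\<in>{a..<b}. rank (\<delta> k) = i" "rank \<epsilon> = i" "a > 0" "a \<le> b"
  shows "\<exists>k\<in>{a..<b}. \<epsilon> = \<delta> k \<and>
    \<beta>' = \<gamma> k @ concat (map (\<lambda>k. [Pow (\<delta> k) (q k)] @ \<gamma> k) [Suc k..<b]) \<and>
    (\<exists>\<eta>. \<beta> = \<eta> @ \<gamma> (k - 1) \<and> (\<eta> = [] \<or> rank_factor (last \<eta>) = Suc i))"
  using assms
proof (induction "b - a" arbitrary: a \<beta>)
  case 0
  then have "\<gamma> (a - 1) = \<beta> @ Pow \<epsilon> r # \<beta>'" by simp
  moreover have "rank (\<gamma> (a - 1)) \<le> i" using "0.prems" by auto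
  ultimately show ?case using "0.prems"(4) by (simp add: rank_le_iff rank_factor_Pow)
next
  case (Suc n)
  let ?F = "\<lambda>k. [Pow (\<delta> k) (q k)] @ \<gamma> k"
  have ab: "a < b" using Suc.hyps(2) by simp
  then have eq: "\<gamma> (a - 1) @ Pow (\<delta> a) (q a) # (\<gamma> a @ concat (map ?F [Suc a..<b])) = \<beta> @ Pow \<epsilon> r # \<beta>'"
    using Suc.prems(1) by (simp add: upt_conv_Cons)
  have low: "rank (\<gamma> (a - 1)) \<le> i" and high: "rank_factor (Pow \<epsilon> r) = Suc i"
    "rank_factor (Pow (\<delta> a) (q a)) = Suc i"
    using Suc.prems ab by (auto simp: rank_factor_Pow)
  from first_high_factor[OF eq low high(1)] show ?case
  proof (elim disjE conjE exE)
    assume "\<beta> = \<gamma> (a - 1)" "Pow (\<delta> a) (q a) = Pow \<epsilon> r" "\<gamma> a @ concat (map ?F [Suc a..<b]) = \<beta>'"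
    then show ?thesis using ab by (intro bexI[of _ a]) auto
  next
    fix \<eta> assume \<eta>: "\<beta> = \<gamma> (a - 1) @ Pow (\<delta> a) (q a) # \<eta>"
      "\<gamma> a @ concat (map ?F [Suc a..<b]) = \<eta> @ Pow \<epsilon> r # \<beta>'"
    have "n = b - Suc a" using Suc.hyps(2) by simp
    then have "\<exists>k\<in>{Suc a..<b}. \<epsilon> = \<delta> k \<and> \<beta>' = \<gamma> k @ concat (map ?F [Suc k..<b]) \<and>
      (\<exists>\<zeta>. \<eta> = \<zeta> @ \<gamma> (k - 1) \<and> (\<zeta> = [] \<or> rank_factor (last \<zeta>) = Suc i))"
      using Suc.prems ab \<eta>(2) by (intro Suc.hyps(1)) auto
    then obtain k \<zeta> where k: "k \<in> {Suc a..<b}" "\<epsilon> = \<delta> k" "\<beta>' = \<gamma> k @ concat (map ?F [Suc k..<b])"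
      "\<eta> = \<zeta> @ \<gamma> (k - 1)" "\<zeta> = [] \<or> rank_factor (last \<zeta>) = Suc i" by blast
    then show ?thesis using \<eta>(1) high(2)
      by (intro bexI[of _ k] conjI exI[of _ "\<gamma> (a - 1) @ Pow (\<delta> a) (q a) # \<zeta>"]) auto
  qed
qed

text \<open>Passes from lists of factors, used for forbidden subterms, to parenthesized words, in
  which (cf.3) and (cf.4) are stated.\<close>

lemma term_prefixI: "prefix \<alpha> \<beta> \<Longrightarrow> term_prefix \<alpha> \<beta>"
  by (auto simp: term_prefix_def prefix_def word_def)

lemma term_suffixI: "suffix \<alpha> \<beta> \<Longrightarrow> term_suffix \<alpha> \<beta>"
  by (auto simp: term_suffix_def suffix_def word_def)

lemma powers_bounded:
  "\<exists>B. \<forall>\<delta> q. Pow \<delta> q \<in> set \<alpha> \<longrightarrow> length \<delta> \<le> B \<and> \<bar>q\<bar> \<le> int B"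
proof (induction \<alpha>)
  case (Cons x \<alpha>)
  then obtain B where B: "\<forall>\<delta> q. Pow \<delta> q \<in> set \<alpha> \<longrightarrow> length \<delta> \<le> B \<and> \<bar>q\<bar> \<le> int B" by blast
  show ?case
  proof (cases x)
    case (Pow \<delta> q)
    have "length \<epsilon> \<le> B + length \<delta> + nat \<bar>q\<bar> \<and> \<bar>r\<bar> \<le> int (B + length \<delta> + nat \<bar>q\<bar>)"
      if "Pow \<epsilon> r \<in> set (x # \<alpha>)" for \<epsilon> r
    proof (cases "Pow \<epsilon> r \<in> set \<alpha>")
      case True
      then have "length \<epsilon> \<le> B" "\<bar>r\<bar> \<le> int B" using B by blast+
      then show ?thesis by linarith
    qed (use that Pow in simp)
    then show ?thesis by blast
  qed (use B in auto)
qed simp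

text \<open>Each kind of forbidden subterm is located in the factorization and then contradicts
  (cf.2), (cf.3), (cf.4) or the choice of \<open>M\<close>.\<close>

lemma canonical_of_rank_locally_canonical:
  assumes fact: "factorization i \<alpha> n \<gamma> \<delta> q"
    and lyn: "\<forall>k\<in>{1..n}. lyndon (\<delta> k)"
    and suf: "\<forall>k\<in>{1..n}. \<not> term_suffix (\<delta> k) (\<gamma> (k - 1))"
    and pre: "\<forall>k\<in>{1..<n}. \<forall>l. \<not> term_prefix (\<delta> k) (\<gamma> k @ tpow (\<delta> (k + 1)) l)"
    and final: "\<not> term_prefix (\<delta> n) (\<gamma> n)"
    and M: "length \<alpha> \<le> M" "\<And>\<delta> q. Pow \<delta> q \<in> set \<alpha> \<Longrightarrow> length \<delta> \<le> M \<and> \<bar>q\<bar> \<le> int M"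
  shows "locally_canonical i M \<alpha>"
  unfolding locally_canonical_def
proof (intro allI impI notI)
  let ?F = "\<lambda>k. [Pow (\<delta> k) (q k)] @ \<gamma> k"
  fix \<xi> assume "sublist \<xi> \<alpha>" and forb: "forbidden i M \<xi>"
  then obtain \<beta> \<beta>' where \<alpha>: "\<alpha> = \<beta> @ \<xi> @ \<beta>'" by (auto simp: sublist_def)
  have at: "\<exists>k\<in>{1..n}. \<epsilon> = \<delta> k \<and> \<eta>' = \<gamma> k @ concat (map ?F [Suc k..<Suc n]) \<and>
    (\<exists>\<zeta>. \<eta> = \<zeta> @ \<gamma> (k - 1) \<and> (\<zeta> = [] \<or> rank_factor (last \<zeta>) = Suc i))"
    if "\<alpha> = \<eta> @ Pow \<epsilon> r # \<eta>'" "rank \<epsilon> = i" for \<eta> \<eta>' \<epsilon> r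
  proof -
    have "\<gamma> (1 - 1) @ concat (map ?F [1..<Suc n]) = \<eta> @ Pow \<epsilon> r # \<eta>'"
      using fact that(1) by (simp add: factorization_def)
    moreover have "\<forall>k\<in>{1 - 1..<Suc n}. rank (\<gamma> k) \<le> i" "\<forall>k\<in>{1..<Suc n}. rank (\<delta> k) = i"
      using fact by (auto simp: factorization_def)
    ultimately have "\<exists>k\<in>{1..<Suc n}. \<epsilon> = \<delta> k \<and> \<eta>' = \<gamma> k @ concat (map ?F [Suc k..<Suc n]) \<and>
        (\<exists>\<zeta>. \<eta> = \<zeta> @ \<gamma> (k - 1) \<and> (\<zeta> = [] \<or> rank_factor (last \<zeta>) = Suc i))"
      using that(2) by (intro factorization_at) simp_all
    then show ?thesis unfolding atLeastLessThanSuc_atLeastAtMost .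
  qed
  from forb show False unfolding forbidden_def
  proof (elim disjE exE conjE)
    fix \<epsilon> r assume \<epsilon>: "\<xi> = [Pow \<epsilon> r]" "rank \<epsilon> = i" "\<not> (lyndon \<epsilon> \<and> length \<epsilon> \<le> M \<and> \<bar>r\<bar> \<le> int M)"
    then have "lyndon \<epsilon>" using at[of \<beta> \<epsilon> r \<beta>'] \<alpha> lyn by auto
    then show False using M(2)[of \<epsilon> r] \<epsilon> \<alpha> by simp
  next
    fix \<epsilon> r assume \<epsilon>: "rank \<epsilon> = i" "\<xi> = \<epsilon> @ [Pow \<epsilon> r]"
    then obtain k \<zeta> where k: "k \<in> {1..n}" "\<epsilon> = \<delta> k" "\<beta> @ \<epsilon> = \<zeta> @ \<gamma> (k - 1)"
      "\<zeta> = [] \<or> rank_factor (last \<zeta>) = Suc i"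
      using at[of "\<beta> @ \<epsilon>" \<epsilon> r \<beta>'] \<alpha> by auto
    \<comment> \<open>A term of rank \<open>i\<close> cannot reach back over the factor of rank
      \<open>i + 1\<close> that ends \<zeta>.\<close>
    have "suffix \<epsilon> (\<gamma> (k - 1))"
    proof -
      from k(3) obtain \<eta> where \<eta>: "\<beta> = \<zeta> @ \<eta> \<and> \<eta> @ \<epsilon> = \<gamma> (k - 1) \<or> \<beta> @ \<eta> = \<zeta> \<and> \<epsilon> = \<eta> @ \<gamma> (k - 1)"
        unfolding append_eq_append_conv2 by blast
      then show ?thesis
      proof
        assume *: "\<beta> @ \<eta> = \<zeta> \<and> \<epsilon> = \<eta> @ \<gamma> (k - 1)"
        have "\<eta> = []"
        proof (rule ccontr)
          assume "\<eta> \<noteq> []"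
          then have "rank_factor (last \<eta>) = Suc i" "last \<eta> \<in> set \<epsilon>" using * k(4) by auto
          then show False using rank_factor_le_rank[of "last \<eta>" \<epsilon>] \<epsilon>(1) by simp
        qed
        then show ?thesis using * by simp
      qed (metis suffixI)
    qed
    then show False using suf k(1,2) term_suffixI by blast
  next
    fix \<epsilon> r assume \<epsilon>: "rank \<epsilon> = i" "\<xi> = Pow \<epsilon> r # \<epsilon>"
    then have "\<alpha> = \<beta> @ Pow \<epsilon> r # (\<epsilon> @ \<beta>')" using \<alpha> by simp
    from at[OF this \<epsilon>(1)]
    obtain k where k: "k \<in> {1..n}" "\<epsilon> = \<delta> k" "\<epsilon> @ \<beta>' = \<gamma> k @ concat (map ?F [Suc k..<Suc n])"
      by blast
    show False
    proof (cases "k = n")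
      case True
      then have "\<epsilon> @ \<beta>' = \<gamma> n" using k(3) by simp
      then have "prefix \<epsilon> (\<gamma> n)" by (metis prefixI)
      then show False using final True k(2) term_prefixI by blast
    next
      case False
      then have "k < n" using k(1) by simp
      then obtain \<zeta> where "\<epsilon> @ \<beta>' = \<gamma> k @ Pow (\<delta> (Suc k)) (q (Suc k)) # \<zeta>"
        using k(3) by (simp add: upt_conv_Cons del: upt_Suc)
      \<comment> \<open>Hence \<epsilon> ends before the next power and is a prefix of
        \<open>\<gamma> k\<close>, which (cf.4) with exponent 0 excludes.\<close>
      moreover have "Pow (\<delta> (Suc k)) (q (Suc k)) \<notin> set \<epsilon>"
        using \<epsilon>(1) rank_factor_le_rank[of "Pow (\<delta> (Suc k)) (q (Suc k))" \<epsilon>] fact \<open>k < n\<close>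
        by (auto simp: factorization_def rank_factor_Pow)
      moreover from calculation(1) obtain \<eta> where
        "\<epsilon> = \<gamma> k @ \<eta> \<and> \<eta> @ \<beta>' = Pow (\<delta> (Suc k)) (q (Suc k)) # \<zeta> \<or> \<epsilon> @ \<eta> = \<gamma> k"
        unfolding append_eq_append_conv2 by blast
      ultimately have "prefix \<epsilon> (\<gamma> k)"
        by (cases \<eta>) (auto intro: prefixI[OF sym])
      moreover have "\<not> term_prefix (\<delta> k) (\<gamma> k)" using pre[rule_format, of k 0] k(1) \<open>k < n\<close> by simp
      ultimately show False using k(2) term_prefixI by blast
    qed
  next
    fix \<epsilon> r \<eta> \<theta> t l assume \<epsilon>: "\<xi> = Pow \<epsilon> r # \<eta> @ [Pow \<theta> t]" "rank \<epsilon> = i" "rank \<theta> = i" "rank \<eta> \<le> i"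
      "prefix \<epsilon> (\<eta> @ tpow \<theta> l)"
    then have "\<alpha> = \<beta> @ Pow \<epsilon> r # (\<eta> @ Pow \<theta> t # \<beta>')" using \<alpha> by simp
    from at[OF this \<epsilon>(2)] obtain k where k: "k \<in> {1..n}" "\<epsilon> = \<delta> k"
      "\<eta> @ Pow \<theta> t # \<beta>' = \<gamma> k @ concat (map ?F [Suc k..<Suc n])"
      by blast
    have low: "rank (\<gamma> k) \<le> i" using fact k(1) by (simp add: factorization_def)
    have "k \<noteq> n"
    proof
      assume "k = n"
      then have "\<eta> @ Pow \<theta> t # \<beta>' = \<gamma> k" using k(3) by simp
      then have "Pow \<theta> t \<in> set (\<gamma> k)" by (metis in_set_conv_decomp)
      then show False using low \<epsilon>(3) by (auto simp: rank_le_iff rank_factor_Pow)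
    qed
    then have "k < n" using k(1) by simp
    then obtain \<zeta> where \<zeta>: "\<eta> @ Pow \<theta> t # \<beta>' = \<gamma> k @ Pow (\<delta> (Suc k)) (q (Suc k)) # \<zeta>"
      using k(3) by (simp add: upt_conv_Cons del: upt_Suc)
    have high: "rank_factor (Pow (\<delta> (Suc k)) (q (Suc k))) = Suc i"
      using fact \<open>k < n\<close> by (auto simp: factorization_def rank_factor_Pow)
    \<comment> \<open>Neither \<eta> nor \<open>\<gamma> k\<close> contains a factor of rank
      \<open>i + 1\<close>, so the power that follows them is the same one.\<close>
    from first_high_factor[OF \<zeta> \<epsilon>(4) high] have "\<gamma> k = \<eta> \<and> \<theta> = \<delta> (Suc k)"
    proof (elim disjE exE conjE)
      fix \<zeta>' assume "\<gamma> k = \<eta> @ Pow \<theta> t # \<zeta>'"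
      then show ?thesis using low \<epsilon>(3) by (simp add: rank_le_iff rank_factor_Pow)
    qed simp
    then have "term_prefix (\<delta> k) (\<gamma> k @ tpow (\<delta> (k + 1)) l)" using \<epsilon>(5) k(2) term_prefixI by simp
    then show False using pre k(1) \<open>k < n\<close> by simp
  next
    assume "M < length \<xi>"
    then show False using M(1) \<alpha> by simp
  qed
qed

lemma square_factorization:
  assumes "factorization i \<alpha> n \<gamma> \<delta> q"
  shows "square i \<alpha> = \<gamma> 0 @ concat (map (\<lambda>k. tpow (\<delta> k) 2 @ \<gamma> k) [1..<Suc n])"
proof -
  have "square i (concat (map (\<lambda>k. [Pow (\<delta> k) (q k)] @ \<gamma> k) ks)) =
      concat (map (\<lambda>k. tpow (\<delta> k) 2 @ \<gamma> k) ks)" if "set ks \<subseteq> {1..n}" for ks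
    using that assms
    by (induction ks) (simp_all add: factorization_def square_low square_factor_def numeral_2_eq_2)
  from this[of "[1..<Suc n]"] show ?thesis
    using assms by (simp add: factorization_def square_low atLeastLessThanSuc_atLeastAtMost del: upt_Suc)
qed

text \<open>Stated for all large \<open>M\<close>, so that the bounds from different ranks, and
  later from two terms, can be merged into one.\<close>

lemma canonical_of_rank_hereditary:
  "canonical_of_rank i \<alpha> \<Longrightarrow> \<exists>M\<^sub>0. \<forall>M\<ge>M\<^sub>0. hereditarily_canonical M i \<alpha>"
proof (induction i arbitrary: \<alpha>)
  case (Suc i)
  then obtain n \<gamma> \<delta> q where fact: "factorization i \<alpha> n \<gamma> \<delta> q"
    and can: "canonical_of_rank i (\<gamma> 0 @ concat (map (\<lambda>k. tpow (\<delta> k) 2 @ \<gamma> k) [1..<Suc n]))"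
    and cf: "\<forall>k\<in>{1..n}. lyndon (\<delta> k)" "\<forall>k\<in>{1..n}. \<not> term_suffix (\<delta> k) (\<gamma> (k - 1))"
      "\<forall>k\<in>{1..<n}. \<forall>l. \<not> term_prefix (\<delta> k) (\<gamma> k @ tpow (\<delta> (k + 1)) l)"
      "\<not> term_prefix (\<delta> n) (\<gamma> n)"
    unfolding canonical_of_rank.simps by blast
  obtain M\<^sub>0 where M\<^sub>0: "\<forall>M\<ge>M\<^sub>0. hereditarily_canonical M i (square i \<alpha>)"
    using Suc.IH[OF can] square_factorization[OF fact] by auto
  obtain B where B: "\<forall>\<delta> q. Pow \<delta> q \<in> set \<alpha> \<longrightarrow> length \<delta> \<le> B \<and> \<bar>q\<bar> \<le> int B"
    using powers_bounded[of \<alpha>] by blast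
  have "hereditarily_canonical M (Suc i) \<alpha>" if "M \<ge> M\<^sub>0 + B + length \<alpha>" for M
  proof -
    have "locally_canonical i M \<alpha>"
      using that B by (intro canonical_of_rank_locally_canonical[OF fact cf]) fastforce+
    then show ?thesis using M\<^sub>0 that by simp
  qed
  then show ?case by blast
qed simp

lemma canonical_form_hereditary:
  assumes "canonical_form \<alpha>"
  obtains i M\<^sub>0 where "\<And>j M. j \<ge> i \<Longrightarrow> M \<ge> M\<^sub>0 \<Longrightarrow> hereditarily_canonical M j \<alpha> \<and> rank \<alpha> \<le> j"
proof -
  obtain i where i: "canonical_of_rank i \<alpha>" using assms by (auto simp: canonical_form_def)
  then have rank: "rank \<alpha> = i" by (cases i) auto
  obtain M\<^sub>0 where M\<^sub>0: "\<forall>M\<ge>M\<^sub>0. hereditarily_canonical M i \<alpha>"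
    using canonical_of_rank_hereditary[OF i] by blast
  have "hereditarily_canonical M j \<alpha> \<and> rank \<alpha> \<le> j" if "j \<ge> i" "M \<ge> M\<^sub>0 + length \<alpha>" for j M
    using that(1)
  proof (induction j rule: dec_induct)
    case base
    then show ?case using M\<^sub>0 rank that(2) by simp
  next
    case (step j)
    then show ?case using that(2) hereditarily_canonical_Suc[of M j \<alpha>] by auto
  qed
  then show thesis by (rule that)
qed

section \<open>Recovering a term from one word of its language\<close>

lemma lang_rank_0:
  assumes "w \<in> lang N p \<alpha>" "rank \<alpha> \<le> 0"
  shows "\<alpha> = map Letter w"
  using assms
proof (induction \<alpha> arbitrary: w)
  case (Cons x \<alpha>)
  then have low: "rank_factor x \<le> 0" "rank \<alpha> \<le> 0" unfolding rank_le_iff by simp_all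
  from low(1) obtain a where "x = Letter a" by (cases x) (simp_all add: rank_factor_Pow)
  then show ?case using Cons.IH[OF _ low(2)] Cons.prems(1) by (auto simp: conc_def)
qed simp

text \<open>Both terms have expansions of the next lower rank whose languages contain
  \<open>w\<close>. These coincide by induction, and expansion is injective. At rank 0 each term is
  \<open>w\<close> itself.\<close>

lemma lang_determines_term:
  assumes "hereditarily_canonical M j \<alpha>" "hereditarily_canonical M j \<beta>" "rank \<alpha> \<le> j" "rank \<beta> \<le> j"
    and "w \<in> lang N p \<alpha>" "w \<in> lang N p \<beta>" and N: "N \<ge> 2 * M + 2" and p: "p > 2 * M"
  shows "\<alpha> = \<beta>"
  using assms(1-6)
proof (induction j arbitrary: \<alpha> \<beta>)
  case 0
  then show ?case using lang_rank_0 by blast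
next
  case (Suc j)
  obtain \<alpha>' where \<alpha>': "expands j N p \<alpha> \<alpha>'" "w \<in> lang N p \<alpha>'"
    using lang_expands Suc.prems(3,5) by blast
  obtain \<beta>' where \<beta>': "expands j N p \<beta> \<beta>'" "w \<in> lang N p \<beta>'"
    using lang_expands Suc.prems(4,6) by blast
  have "\<alpha>' = \<beta>'"
    using \<alpha>' \<beta>' Suc.prems(1,2) N
    by (intro Suc.IH)
      (auto intro: expands_rank elim!: hereditarily_canonical_expands
        simp del: hereditarily_canonical.simps)
  then show ?case
    using expands_injective[OF \<alpha>'(1), of \<beta> M] \<beta>'(1) Suc.prems(1,2) N p by simp
qed

theorem theorem6p1:
  fixes \<alpha> \<beta> :: "'a::{finite,linorder} kterm"
  assumes "kterm \<alpha>" and "kterm \<beta>"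
    and "canonical_form \<alpha>" and "canonical_form \<beta>"
    and "all_finite_semigroups_satisfy \<alpha> \<beta>"
  shows "\<alpha> = \<beta>"
proof -
  obtain i\<^sub>1 M\<^sub>1 where 1: "\<And>j M. j \<ge> i\<^sub>1 \<Longrightarrow> M \<ge> M\<^sub>1 \<Longrightarrow> hereditarily_canonical M j \<alpha> \<and> rank \<alpha> \<le> j"
    using canonical_form_hereditary[OF assms(3)] by blast
  obtain i\<^sub>2 M\<^sub>2 where 2: "\<And>j M. j \<ge> i\<^sub>2 \<Longrightarrow> M \<ge> M\<^sub>2 \<Longrightarrow> hereditarily_canonical M j \<beta> \<and> rank \<beta> \<le> j"
    using canonical_form_hereditary[OF assms(4)] by blast
  \<comment> \<open>A bound common to both terms; the values for \<open>N\<close> and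
    \<open>p\<close> below are the least ones that \<open>lang_determines_term\<close>
    accepts.\<close>
  define M where "M = max M\<^sub>1 M\<^sub>2"
  obtain w where "w \<in> lang (2 * M + 2) (2 * M + 1) \<alpha>" "w \<in> lang (2 * M + 2) (2 * M + 1) \<beta>"
    using satisfied_imp_lang_meet[OF assms(1,2,5), of "2 * M + 2" "2 * M + 1"] by auto
  then show ?thesis
    \<comment> \<open>The ranks of the two terms are not known to agree, so both are raised to a
      common level.\<close>
    using 1[of "max i\<^sub>1 i\<^sub>2" M] 2[of "max i\<^sub>1 i\<^sub>2" M]
    by (intro lang_determines_term[of M "max i\<^sub>1 i\<^sub>2" \<alpha> \<beta> w "2 * M + 2" "2 * M + 1"]) (auto simp: M_def)
qed

end
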